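(* Let $\lambda>0$, $p>2$, $\varphi_0\in H^1(\mathbb{R}^2)$, and let $\varphi\in C([0,T);H^1(\mathbb{R}^2))$ be the maximal solution of the Cauchy problem of the time-dependent Chern–Simons–Schrödinger system with $\varphi(0)=\varphi_0$. If either (a) $2<p<4$, or (b) $p=4$ and $\|\varphi_0\|_2$ is sufficiently small, or (c) $p>4$ and $\varphi_0\in\mathcal O_c:=\{u\in S(c):E(u)<\gamma(c),\ Q(u)>0\}$ for some $c>0$, then $T=\infty$.
   Context: All functions are complex-valued. $G_j(x)=-\frac{1}{2\pi}\frac{x_j}{|x|^2}$; $A_1(u)=-\frac12G_2*|u|^2$, $A_2(u)=\frac12G_1*|u|^2$, $D_j=\partial_j+iA_j$; $E(u)=\frac12\int(|D_1u|^2+|D_2u|^2)-\frac{\lambda}{p}\int|u|^p$; $S(c)=\{u\in H^1:\|u\|_2^2=c\}$; $Q(u)=\int(|D_1u|^2+|D_2u|^2)-\frac{\lambda(p-2)}{p}\int|u|^p$; $\mathcal M(c)=\{u\in S(c):Q(u)=0\}$; $\gamma(c)=\inf_{\mathcal M(c)}E$. The time-dependent system: $iD_t\varphi+(D_1D_1+D_2D_2)\varphi=-\lambda|\varphi|^{p-2}\varphi$, $\partial_tA_1-\partial_1A_0=-\mathrm{Im}(\bar\varphi D_2\varphi)$, $\partial_tA_2-\partial_2A_0=\mathrm{Im}(\bar\varphi D_1\varphi)$, $\partial_1A_2-\partial_2A_1=-\frac12|\varphi|^2$, $D_t=\partial_t+iA_0$, with Coulomb gauge $\partial_1A_1+\partial_2A_2=0$.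 Standing fact used (local theory): for $\varphi_0\in H^1$ there is a unique maximal solution $\varphi\in C([0,T);H^1)$ conserving $\|\varphi(t)\|_2$ and $E(\varphi(t))$, and either $T=\infty$ or $\|D_1\varphi(t)\|_2+\|D_2\varphi(t)\|_2\to\infty$ as $t\to T^-$. *)

theory Defs
  imports "HOL-Analysis.Analysis"
begin

type_synonym cfun = "real^2 \<Rightarrow> complex"

definition partial :: "2 \<Rightarrow> (real^2 \<Rightarrow> real) \<Rightarrow> real^2 \<Rightarrow> real" where
  "partial j \<psi> x = deriv (\<lambda>t. \<psi> (x + t *\<^sub>R axis j 1)) 0"

definition test_fun :: "(real^2 \<Rightarrow> real) \<Rightarrow> bool" where
  "test_fun \<psi> \<longleftrightarrow>
     (\<forall>j x. ((\<lambda>t. \<psi> (x + t *\<^sub>R axis j 1)) has_real_derivative partial j \<psi> x) (at 0)) \<and>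
     (\<forall>j. continuous_on UNIV (partial j \<psi>)) \<and>
     compact (closure {x. \<psi> x \<noteq> 0})"

definition sq_int :: "cfun \<Rightarrow> bool" where
  "sq_int u \<longleftrightarrow> u \<in> borel_measurable lborel \<and> integrable lborel (\<lambda>x. (cmod (u x))\<^sup>2)"

definition weak_pd :: "2 \<Rightarrow> cfun \<Rightarrow> cfun \<Rightarrow> bool" where
  "weak_pd j u g \<longleftrightarrow> (\<forall>\<psi>. test_fun \<psi> \<longrightarrow>
      (LINT x|lborel. u x * complex_of_real (partial j \<psi> x))
        = - (LINT x|lborel. g x * complex_of_real (\<psi> x)))"

definition H1 :: "cfun \<Rightarrow> bool" where
  "H1 u \<longleftrightarrow> sq_int u \<and> (\<forall>j. \<exists>g. sq_int g \<and> weak_pd j u g)"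

definition wd :: "2 \<Rightarrow> cfun \<Rightarrow> cfun" where
  "wd j u = (SOME g. sq_int g \<and> weak_pd j u g)"

definition L2norm :: "cfun \<Rightarrow> real" where
  "L2norm u = sqrt (LINT x|lborel. (cmod (u x))\<^sup>2)"

definition G :: "2 \<Rightarrow> real^2 \<Rightarrow> real" where
  "G j z = - (1 / (2 * pi)) * (z $ j) / (norm z)\<^sup>2"

definition Apot :: "2 \<Rightarrow> cfun \<Rightarrow> real^2 \<Rightarrow> real" where
  "Apot j u x = (if j = 1
      then - (1/2) * (LINT y|lborel. G 2 (x - y) * (cmod (u y))\<^sup>2)
      else (1/2) * (LINT y|lborel. G 1 (x - y) * (cmod (u y))\<^sup>2))"

definition Dcov :: "2 \<Rightarrow> cfun \<Rightarrow> cfun" where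
  "Dcov j u x = wd j u x + \<i> * complex_of_real (Apot j u x) * u x"

definition Energy :: "real \<Rightarrow> real \<Rightarrow> cfun \<Rightarrow> real" where
  "Energy lam p u = (1/2) * (LINT x|lborel. (cmod (Dcov 1 u x))\<^sup>2 + (cmod (Dcov 2 u x))\<^sup>2)
      - lam / p * (LINT x|lborel. (cmod (u x)) powr p)"

definition Qf :: "real \<Rightarrow> real \<Rightarrow> cfun \<Rightarrow> real" where
  "Qf lam p u = (LINT x|lborel. (cmod (Dcov 1 u x))\<^sup>2 + (cmod (Dcov 2 u x))\<^sup>2)
      - lam * (p - 2) / p * (LINT x|lborel. (cmod (u x)) powr p)"

definition Sc :: "real \<Rightarrow> cfun set" where
  "Sc c = {u. H1 u \<and> (LINT x|lborel. (cmod (u x))\<^sup>2) = c}"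

definition Mc :: "real \<Rightarrow> real \<Rightarrow> real \<Rightarrow> cfun set" where
  "Mc lam p c = {u \<in> Sc c. Qf lam p u = 0}"

text \<open>gamma(c) = inf over M(c) of E, in the extended reals (inf of the empty set is +infinity).\<close>
definition gamma_c :: "real \<Rightarrow> real \<Rightarrow> real \<Rightarrow> ereal" where
  "gamma_c lam p c = Inf ((\<lambda>u. ereal (Energy lam p u)) ` Mc lam p c)"

definition Oc :: "real \<Rightarrow> real \<Rightarrow> real \<Rightarrow> cfun set" where
  "Oc lam p c = {u \<in> Sc c. ereal (Energy lam p u) < gamma_c lam p c \<and> Qf lam p u > 0}"

definition H1norm :: "cfun \<Rightarrow> real" where
  "H1norm u = sqrt ((LINT x|lborel. (cmod (u x))\<^sup>2)
      + (LINT x|lborel. (cmod (wd 1 u x))\<^sup>2) + (LINT x|lborel. (cmod (wd 2 u x))\<^sup>2))"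

text \<open>The maximal H^1 solution phi on [0,T) with phi(0) = phi0, described through the
  properties provided by the local well-posedness theory (standing fact):
  phi in C([0,T);H^1), conservation of the L^2 norm and of the energy, and the
  blow-up alternative.\<close>
definition max_sol :: "real \<Rightarrow> real \<Rightarrow> cfun \<Rightarrow> ereal \<Rightarrow> (real \<Rightarrow> cfun) \<Rightarrow> bool" where
  "max_sol lam p \<phi>0 T \<phi> \<longleftrightarrow>
     T > 0 \<and> H1 \<phi>0 \<and> \<phi> 0 = \<phi>0 \<and>
     (\<forall>t. 0 \<le> t \<and> ereal t < T \<longrightarrow> H1 (\<phi> t)) \<and>
     (\<forall>t. 0 \<le> t \<and> ereal t < T \<longrightarrow>
        ((\<lambda>s. H1norm (\<lambda>x. \<phi> s x - \<phi> t x)) \<longlongrightarrow> 0) (at t within {s. 0 \<le> s \<and> ereal s < T})) \<and>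
     (\<forall>t. 0 \<le> t \<and> ereal t < T \<longrightarrow> L2norm (\<phi> t) = L2norm \<phi>0) \<and>
     (\<forall>t. 0 \<le> t \<and> ereal t < T \<longrightarrow> Energy lam p (\<phi> t) = Energy lam p \<phi>0) \<and>
     (T \<noteq> \<infinity> \<longrightarrow>
        filterlim (\<lambda>t. L2norm (Dcov 1 (\<phi> t)) + L2norm (Dcov 2 (\<phi> t))) at_top
          (at_left (real_of_ereal T)))"

end

theory Submission
  imports Defs
begin

text \<open>
  The energy controls the covariant kinetic energy, which excludes the blow-up alternative. The tool is the
  Gagliardo--Nirenberg inequality for the covariant gradient, and it is reached without mollification. A weak
  derivative yields absolutely continuous representatives on almost every line parallel to an axis, so
  \<open>|u|^(k+2)\<close> is at most a multiple of the line integral of \<open>|u|^k |Re (cnj u * \<partial>\<^sub>j u)|\<close>. Multiplying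
  the bounds for the two directions and integrating gives
  \<open>\<integral>|u|^(2k+4) \<le> C \<parallel>D u\<parallel>\<^sup>2 \<integral>|u|^(2k+2)\<close>, because the gauge potential is real and hence
  \<open>Re (cnj u * \<partial>\<^sub>j u) = Re (cnj u * D\<^sub>j u)\<close>.

  For \<open>p < 4\<close>, and for \<open>p = 4\<close> with small mass, the nonlinear term is absorbed by the kinetic energy.
  For \<open>p > 4\<close> the functional \<open>Qf\<close> stays positive along the flow, as a zero would put the solution
  into \<open>Mc\<close> with energy below \<open>gamma_c\<close>; and \<open>Qf > 0\<close> bounds the kinetic energy by the conserved
  energy.
\<close>

subsection \<open>Integration over lines parallel to an axis\<close>

text \<open>Two obstacles shape the proof. First, \<open>LINT\<close> returns 0 on non-integrable
  functions, so \<open>Energy\<close> and \<open>Qf\<close> carry information only once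
  \<open>Dcov j u\<close> is known to lie in L^2, and an inequality with its norm on the right
  cannot supply that. The Gagliardo-Nirenberg inequality is therefore proved for an abstract family
  \<open>D\<close> and used twice: with \<open>wd\<close> it puts u into L^6, which is enough for
  A_j u to be in L^2; after that it is applied to \<open>Dcov\<close>. Second, u is merely
  absolutely continuous on almost every line, so |u|^(k+2) is estimated through increments instead
  of a chain rule. Iteration reaches even exponents only. A general p is interpolated between 2 and
  an even exponent, splitting the values of |u| at a free height s. For p < 4 a large s makes the
  coefficient of the kinetic energy small; for p = 4 that coefficient does not depend on s, and only
  a small mass helps.\<close>

definition slice :: "2 \<Rightarrow> real \<Rightarrow> real \<Rightarrow> real^2" where
  "slice j s y = (\<chi> i. if i = j then s else y)"

lemma slice_nth: "slice j s y $ i = (if i = j then s else y)"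
  by (simp add: slice_def)

lemma slice_measurable [measurable]:
  "(\<lambda>z. slice j (fst z) (snd z)) \<in> borel_measurable borel"
proof -
  have "continuous_on UNIV (\<lambda>z::real\<times>real. slice j (fst z) (snd z))"
    unfolding slice_def by (rule continuous_on_vec_lambda) (case_tac "i = j"; auto intro!: continuous_intros)
  then show ?thesis by (rule borel_measurable_continuous_onI)
qed

lemma measurable_slice [measurable (raw)]:
  assumes "f \<in> borel_measurable M" "g \<in> borel_measurable M"
  shows "(\<lambda>z. slice j (f z) (g z)) \<in> borel_measurable M"
proof -
  have "(\<lambda>z. (f z, g z)) \<in> borel_measurable M"
    using assms by measurable
  from measurable_compose[OF this slice_measurable[of j]] show ?thesis by simp
qed

lemma UNIV_two: "(i::2) \<noteq> j \<Longrightarrow> UNIV = {i, j}"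
  using exhaust_2[of i] exhaust_2[of j] by (auto simp: UNIV_2)

lemma Basis_real2: "(Basis :: (real^2) set) = range (\<lambda>i. axis i 1)"
  by (auto simp: Basis_vec_def)

text \<open>Lebesgue measure is determined by the volumes of boxes, and the preimage of a box is a
  rectangle whose first side is the j-th one.\<close>

lemma lborel_slice: "lborel = distr lborel borel (\<lambda>z. slice j (fst z) (snd z))"
proof (rule lborel_eqI)
  fix l u :: "real^2"
  assume le: "\<And>b. b \<in> Basis \<Longrightarrow> l \<bullet> b \<le> u \<bullet> b"
  then have lu: "l $ i \<le> u $ i" for i
    using le[of "axis i 1"] by (simp add: inner_axis)
  obtain k :: 2 where k: "k \<noteq> j"
    by (metis one_neq_zero)
  have U: "UNIV = {j,k}" using UNIV_two[of j k] k by simp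
  then have all: "(\<forall>i. P i) \<longleftrightarrow> P j \<and> P k" for P by (metis UNIV_I insertE singletonD)
  have "(\<lambda>z. slice j (fst z) (snd z)) -` box l u = {l$j<..<u$j} \<times> {l$k<..<u$k}"
    using k by (auto simp: mem_box_cart slice_nth all)
  then have "emeasure (distr lborel borel (\<lambda>z. slice j (fst z) (snd z))) (box l u)
      = emeasure (lborel \<Otimes>\<^sub>M lborel) ({l$j<..<u$j} \<times> {l$k<..<u$k})"
    by (subst emeasure_distr) (auto simp: lborel_prod)
  also have "\<dots> = ennreal ((u$j-l$j)*(u$k-l$k))"
    using lu by (simp add: lborel.emeasure_pair_measure_Times ennreal_mult)
  also have "(u$j-l$j)*(u$k-l$k) = (\<Prod>i\<in>UNIV. (u-l) $ i)"
    using k by (simp add: U)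
  also have "\<dots> = (\<Prod>b\<in>Basis. (u - l) \<bullet> b)"
    unfolding Basis_real2
    by (subst prod.reindex) (auto simp: inj_on_def axis_eq_axis inner_axis)
  finally show "emeasure (distr lborel borel (\<lambda>z. slice j (fst z) (snd z))) (box l u)
      = ennreal (\<Prod>b\<in>Basis. (u - l) \<bullet> b)" .
qed simp

lemma nn_integral_slice:
  assumes [measurable]: "f \<in> borel_measurable borel"
  shows "(\<integral>\<^sup>+x. f x \<partial>lborel) = (\<integral>\<^sup>+y. (\<integral>\<^sup>+s. f (slice j s y) \<partial>lborel) \<partial>lborel)"
proof -
  have "(\<integral>\<^sup>+x. f x \<partial>lborel) = (\<integral>\<^sup>+z. f (slice j (fst z) (snd z)) \<partial>(lborel \<Otimes>\<^sub>M lborel))"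
    unfolding lborel_prod by (subst lborel_slice[of j]) (simp add: nn_integral_distr)
  also have "\<dots> = (\<integral>\<^sup>+y. (\<integral>\<^sup>+s. f (slice j s y) \<partial>lborel) \<partial>lborel)"
    by (subst lborel_pair.nn_integral_snd[symmetric]) auto
  finally show ?thesis .
qed

text \<open>The exceptional set is enclosed in a Borel null set \<open>N\<close>; Tonelli for the
  indicator of \<open>N\<close> then makes almost every slice of it null.\<close>

lemma AE_slice:
  assumes "AE x in lborel. P x"
  shows "AE y in lborel. AE s in lborel. P (slice j s y)"
proof -
  from assms obtain N where N: "{x. \<not> P x} \<subseteq> N" "N \<in> sets borel" "emeasure lborel N = 0"
    by (auto elim!: AE_E)
  have [measurable]: "N \<in> sets borel" by fact
  have "(\<integral>\<^sup>+y. (\<integral>\<^sup>+s. indicator N (slice j s y) \<partial>lborel) \<partial>lborel) = 0"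
    by (subst nn_integral_slice[symmetric]) (use N in auto)
  then have "AE y in lborel. (\<integral>\<^sup>+s. indicator N (slice j s y) \<partial>lborel) = 0"
    by (subst (asm) nn_integral_0_iff_AE) auto
  then show ?thesis
  proof eventually_elim
    case (elim y)
    then have "AE s in lborel. indicator N (slice j s y) = (0::ennreal)"
      by (subst (asm) nn_integral_0_iff_AE) auto
    then show ?case by eventually_elim (use N in \<open>auto split: split_indicator_asm\<close>)
  qed
qed

subsection \<open>Powers of absolutely continuous functions on the line\<close>

text \<open>Reduces |v|^(k+2) to |v|^2, whose increment is a real bilinear expression in the sum and
  the difference of the two values. Induction on k treats ordered arguments; symmetry does the
  rest.\<close>

lemma power_diff_le_square_diff:
  fixes a b :: real
  assumes "0 \<le> a" "0 \<le> b"
  shows "\<bar>a^(k+2) - b^(k+2)\<bar> \<le> real (k+1) * (max a b)^k * \<bar>a^2 - b^2\<bar>"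
proof -
  have *: "a^(k+2) - b^(k+2) \<le> real (k+1) * a^k * (a^2 - b^2)" if ab: "0 \<le> b" "b \<le> a" for a b :: real
  proof (induction k)
    case (Suc k)
    have "a ^ (Suc k + 2) - b ^ (Suc k + 2) = a * (a^(k+2) - b^(k+2)) + b^(k+2) * (a - b)"
      by (simp add: algebra_simps)
    also have "\<dots> \<le> a * (real (k+1) * a^k * (a^2 - b^2)) + b^(k+2) * (a - b)"
      using Suc ab by (intro add_right_mono mult_left_mono) auto
    also have "b^(k+2) * (a - b) \<le> a^(k+1) * (a+b) * (a - b)"
    proof (intro mult_right_mono)
      have "b^(k+2) = b^(k+1) * b" by simp
      also have "\<dots> \<le> a^(k+1) * (a + b)"
        using ab by (intro mult_mono power_mono) auto
      finally show "b^(k+2) \<le> a^(k+1) * (a+b)" .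
    qed (use ab in auto)
    also have "a * (real (k+1) * a^k * (a^2 - b^2)) + a^(k+1) * (a+b) * (a - b)
        = real (Suc k + 1) * a ^ Suc k * (a\<^sup>2 - b\<^sup>2)"
      by (simp add: algebra_simps power2_eq_square)
    finally show ?case by simp
  qed (simp add: power2_eq_square)
  have sq: "b^n \<le> a^n" if "0 \<le> b" "b \<le> a" for a b :: real and n
    using that by (rule power_mono[rotated])
  show ?thesis
  proof (cases "b \<le> a")
    case True
    then show ?thesis using *[of b a] sq[of b a "k+2"] sq[of b a 2] assms by (simp add: max_def)
  next
    case False
    then show ?thesis using *[of a b] sq[of a b "k+2"] sq[of a b 2] assms by (simp add: max_def)
  qed
qed

lemma Re_of_real_mult: "Re (complex_of_real c * z) = c * Re z"
  by simp

lemma set_integral_combine: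
  fixes h :: "real \<Rightarrow> 'a::euclidean_space"
  assumes "set_integrable lborel {a..c} h" "a \<le> b" "b \<le> c"
  shows "(LINT s:{a..c}|lborel. h s) = (LINT s:{a..b}|lborel. h s) + (LINT s:{b..c}|lborel. h s)"
proof -
  have 1: "set_integrable lborel {a..b} h" "set_integrable lborel {b..c} h"
    using assms by (auto intro: set_integrable_subset)
  show ?thesis
    using set_borel_integral_eq_integral[OF assms(1)] set_borel_integral_eq_integral[OF 1(1)]
      set_borel_integral_eq_integral[OF 1(2)] assms
    by (simp add: Henstock_Kurzweil_Integration.integral_combine)
qed

lemma set_integrable_continuous_mult:
  fixes c g :: "real \<Rightarrow> complex"
  assumes "set_integrable lborel {a..b} g" "continuous_on {a..b} c"
  shows "set_integrable lborel {a..b} (\<lambda>s. c s * g s)"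
proof -
  have "compact (c ` {a..b})" using assms(2) by (intro compact_continuous_image) auto
  then obtain B where B: "\<And>s. s \<in> {a..b} \<Longrightarrow> cmod (c s) \<le> B"
    by (meson bounded_iff compact_imp_bounded imageI)
  have m: "(\<lambda>s. indicator {a..b} s *\<^sub>R c s) \<in> borel_measurable borel"
    by (rule borel_measurable_continuous_on_indicator) (use assms in auto)
  have g: "integrable lborel (\<lambda>s. indicator {a..b} s *\<^sub>R g s)"
    using assms(1) by (simp add: set_integrable_def)
  have "integrable lborel (\<lambda>s. (indicator {a..b} s *\<^sub>R c s) * (indicator {a..b} s *\<^sub>R g s))"
  proof (rule Bochner_Integration.integrable_bound[OF integrable_mult_right[OF integrable_norm[OF g], of B]])
    show "(\<lambda>s. (indicator {a..b} s *\<^sub>R c s) * (indicator {a..b} s *\<^sub>R g s)) \<in> borel_measurable lborel"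
      using m borel_measurable_integrable[OF g] by measurable
    show "AE s in lborel. norm ((indicator {a..b} s *\<^sub>R c s) * (indicator {a..b} s *\<^sub>R g s))
        \<le> norm (B * norm (indicator {a..b} s *\<^sub>R g s))"
      using B by (intro AE_I2) (auto simp: norm_mult indicator_def intro!: mult_right_mono order_trans[OF _ abs_ge_self])
  qed
  moreover have "(\<lambda>s. (indicator {a..b} s *\<^sub>R c s) * (indicator {a..b} s *\<^sub>R g s))
     = (\<lambda>s. indicator {a..b} s *\<^sub>R (c s * g s))"
    by (auto simp: indicator_def)
  ultimately show ?thesis by (simp add: set_integrable_def)
qed

text \<open>Near \<open>s\<close> the increment of \<open>|v|^(k+2)\<close> is at most
  \<open>2 (k+1) |v s|^k |Re (cnj (v s) * (v b - v a))|\<close> up to a small multiple of the integral of \<open>|\<gamma>|\<close>;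
  Bolzano's bisection makes this global.\<close>

lemma primitive_power_le:
  fixes v \<gamma> :: "real \<Rightarrow> complex"
  assumes int: "\<And>a b. set_integrable lborel {a..b} \<gamma>"
    and eq: "\<And>a b. a \<le> b \<Longrightarrow> v b - v a = (LINT s:{a..b}|lborel. \<gamma> s)"
    and cont: "continuous_on UNIV v"
    and "a \<le> b"
  shows "\<bar>cmod (v b) ^ (k+2) - cmod (v a)^(k+2)\<bar>
     \<le> 2 * real (k+1) * (LINT s:{a..b}|lborel. cmod (v s)^k * \<bar>Re (cnj (v s) * \<gamma> s)\<bar>)"
    (is "?l a b \<le> 2 * real (k+1) * (LINT s:_|_. ?h s)")
proof -
  have cmult: "set_integrable lborel {a..b} (\<lambda>s. c s * \<gamma> s)" if "continuous_on UNIV c" for a b c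
    using set_integrable_continuous_mult[OF int] continuous_on_subset[OF that] by blast
  have re: "set_integrable lborel {a..b} (\<lambda>s. \<bar>Re (g s)\<bar>)"
     "set_integrable lborel {a..b} (\<lambda>s. (Re (g s)))"
    if "set_integrable lborel {a..b} g" for a b g
  proof -
    have "integrable lborel (\<lambda>s. Re (indicator {a..b} s *\<^sub>R g s))"
      using that by (simp add: set_integrable_def del: scaleR_complex.simps)
    then show "set_integrable lborel {a..b} (\<lambda>s. (Re (g s)))"
      by (simp add: set_integrable_def)
    then show "set_integrable lborel {a..b} (\<lambda>s. \<bar>Re (g s)\<bar>)"
      by (rule set_integrable_abs)
  qed
  have h_eq: "?h = (\<lambda>s. \<bar>Re (complex_of_real (cmod (v s)^k) * cnj (v s) * \<gamma> s)\<bar>)"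
    unfolding mult.assoc Re_of_real_mult abs_mult by simp
  have hint: "set_integrable lborel {a..b} ?h" for a b
    unfolding h_eq by (intro re cmult continuous_intros cont)
  have gint: "set_integrable lborel {a..b} (\<lambda>s. cmod (\<gamma> s))" for a b
    using int by (intro set_integrable_norm)
  define c where "c = real (k+1)"
  have c: "c > 0" by (simp add: c_def)
  \<comment> \<open>Both sides suit bisection: the right one is additive over adjacent intervals,
    the left one obeys the triangle inequality. Only short intervals around a point remain, where
    the \<open>\<epsilon>\<close> term pays for freezing a continuous weight.\<close>
  have main: "?l a b \<le> (LINT s:{a..b}|lborel. 2 * c * ?h s + c * \<epsilon> * cmod (\<gamma> s))" if "\<epsilon> > 0" for \<epsilon>
    using \<open>a \<le> b\<close>
  proof (induction rule: Bolzano)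
    case (trans a b c')
    have "set_integrable lborel {a..c'} (\<lambda>s. 2 * c * ?h s + c * \<epsilon> * cmod (\<gamma> s))"
      using hint gint by (intro set_integral_add set_integrable_mult_right) auto
    from set_integral_combine[OF this trans(3,4)] trans(1,2) show ?case by linarith
  next
    case (local s0)
    \<comment> \<open>Up to the factor \<open>c\<close>, the increment over [a, b] is bounded by
      testing v b - v a against \<open>W (a, b)\<close>. On the diagonal \<open>W (s, s)\<close> is
      2 |v s|^k v s, which turns the test into 2 * \<open>?h s\<close>.\<close>
    define W where "W = (\<lambda>z::real\<times>real. of_real (max (cmod (v (fst z))) (cmod (v (snd z)))^k) * (v (fst z) + v (snd z)))"
    have vc: "isCont v x" for x using cont by (simp add: continuous_on_eq_continuous_at)
    have "continuous_on UNIV W"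
      unfolding W_def using cont
      by (intro continuous_intros continuous_on_compose2[OF cont] ) auto
    then have "isCont W (s0,s0)" by (simp add: continuous_on_eq_continuous_at)
    then obtain d where d: "d > 0" "\<And>z. dist z (s0,s0) < d \<Longrightarrow> dist (W z) (W (s0,s0)) < \<epsilon>/2"
      using \<open>\<epsilon> > 0\<close> unfolding continuous_at_eps_delta by (meson half_gt_zero)
    show ?case
    proof (intro exI[of _ "d/2"] conjI allI impI)
      fix a b assume ab: "a \<le> s0 \<and> s0 \<le> b \<and> b - a < d/2"
      have dd: "dist (s,t) (s0,s0) < d" if "s \<in> {a..b}" "t \<in> {a..b}" for s t
      proof -
        have "dist (s,t) (s0,s0) \<le> \<bar>s - s0\<bar> + \<bar>t - s0\<bar>"
          unfolding dist_prod_def using sqrt_sum_squares_le_sum_abs[of "s-s0" "t-s0"] by (simp add: dist_real_def)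
        also have "\<dots> < d" using that ab by auto
        finally show ?thesis .
      qed
      have Wd: "cmod (W (a,b) - W (s,s)) \<le> \<epsilon>" if "s \<in> {a..b}" for s
      proof -
        have "dist (W (a,b)) (W (s,s)) \<le> dist (W (a,b)) (W (s0,s0)) + dist (W (s,s)) (W (s0,s0))"
          by (rule dist_triangle2)
        also have "\<dots> < \<epsilon>/2 + \<epsilon>/2"
          using d(2) dd that ab by (intro add_strict_mono) auto
        finally show ?thesis by (simp add: dist_norm)
      qed
      define m where "m = max (cmod (v a)) (cmod (v b))"
      have sq: "cmod (v b)^2 - cmod (v a)^2 = Re (cnj (v a + v b) * (v b - v a))"
        unfolding cmod_power2 by (simp add: algebra_simps power2_eq_square)
      have "?l a b \<le> c * (m^k * \<bar>cmod (v b)^2 - cmod (v a)^2\<bar>)"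
        using power_diff_le_square_diff[of "cmod (v b)" "cmod (v a)" k]
        by (simp add: c_def m_def max.commute mult.assoc)
      also have "m^k * \<bar>cmod (v b)^2 - cmod (v a)^2\<bar> = \<bar>Re (cnj (W (a,b)) * (v b - v a))\<bar>"
      proof -
        have "m \<ge> 0" by (simp add: m_def le_max_iff_disj)
        have "cnj (W (a,b)) * (v b - v a) = of_real (m^k) * (cnj (v a + v b) * (v b - v a))"
          by (simp add: W_def m_def algebra_simps)
        then have "Re (cnj (W (a,b)) * (v b - v a)) = m^k * Re (cnj (v a + v b) * (v b - v a))"
          by (simp only: Re_of_real_mult)
        then show ?thesis using \<open>m \<ge> 0\<close> unfolding sq by (simp add: abs_mult)
      qed
      also have "cnj (W (a,b)) * (v b - v a) = (LINT s:{a..b}|lborel. cnj (W (a,b)) * \<gamma> s)"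
        using ab eq[of a b] by simp
      also have "Re \<dots> = (LINT s:{a..b}|lborel. Re (cnj (W (a,b)) * \<gamma> s))"
      proof -
        have "Re (LINT s|lborel. indicator {a..b} s *\<^sub>R (cnj (W (a,b)) * \<gamma> s))
           = (LINT s|lborel. Re (indicator {a..b} s *\<^sub>R (cnj (W (a,b)) * \<gamma> s)))"
          by (rule integral_Re[symmetric]) (use cmult[of "\<lambda>_. cnj (W (a,b))" a b] in \<open>simp add: set_integrable_def\<close>)
        then show ?thesis unfolding set_lebesgue_integral_def by (simp only: scaleR_complex.sel real_scaleR_def)
      qed
      also have "\<bar>\<dots>\<bar> \<le> (LINT s:{a..b}|lborel. \<bar>Re (cnj (W (a,b)) * \<gamma> s)\<bar>)"
        unfolding set_lebesgue_integral_def by (rule order_trans[OF integral_abs_bound]) (simp add: abs_mult)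
      also have "\<dots> \<le> (LINT s:{a..b}|lborel. 2 * ?h s + \<epsilon> * cmod (\<gamma> s))"
      proof (rule set_integral_mono)
        fix s assume s: "s \<in> {a..b}"
        have "2 * ?h s = \<bar>Re (cnj (W (s,s)) * \<gamma> s)\<bar>"
        proof -
          have "cnj (W (s,s)) * \<gamma> s = complex_of_real 2 * (complex_of_real (cmod (v s)^k) * cnj (v s) * \<gamma> s)"
            by (simp add: W_def algebra_simps)
          then show ?thesis unfolding fun_cong[OF h_eq] by (simp only: Re_of_real_mult abs_mult)
        qed
        moreover have "\<bar>Re (cnj (W (a,b)) * \<gamma> s)\<bar> \<le> \<bar>Re (cnj (W (s,s)) * \<gamma> s)\<bar> + \<bar>Re (cnj (W (a,b) - W (s,s)) * \<gamma> s)\<bar>"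
          by (simp add: algebra_simps)
        moreover have "\<bar>Re (cnj (W (a,b) - W (s,s)) * \<gamma> s)\<bar> \<le> cmod (W (a,b) - W (s,s)) * cmod (\<gamma> s)"
          using abs_Re_le_cmod[of "cnj (W (a,b) - W (s,s)) * \<gamma> s"] by (simp only: norm_mult complex_mod_cnj)
        moreover have "\<dots> \<le> \<epsilon> * cmod (\<gamma> s)"
          using Wd[OF s] by (intro mult_right_mono) auto
        ultimately show "\<bar>Re (cnj (W (a,b)) * \<gamma> s)\<bar> \<le> 2 * ?h s + \<epsilon> * cmod (\<gamma> s)" by linarith
      next
        show "set_integrable lborel {a..b} (\<lambda>s. \<bar>Re (cnj (W (a,b)) * \<gamma> s)\<bar>)"
          by (intro re cmult continuous_on_const)
        show "set_integrable lborel {a..b} (\<lambda>s. 2 * ?h s + \<epsilon> * cmod (\<gamma> s))"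
          using hint gint by (intro set_integral_add set_integrable_mult_right)
      qed
      finally have "?l a b \<le> c * (LINT s:{a..b}|lborel. 2 * ?h s + \<epsilon> * cmod (\<gamma> s))"
        using c by (simp add: mult_left_mono)
      also have "\<dots> = (LINT s:{a..b}|lborel. 2 * c * ?h s + c * \<epsilon> * cmod (\<gamma> s))"
        by (subst set_integral_mult_right[symmetric]) (simp add: algebra_simps)
      finally show "?l a b \<le> \<dots>" .
    qed (use d in auto)
  qed
  define J where "J = (LINT s:{a..b}|lborel. cmod (\<gamma> s))"
  have "?l a b \<le> 2 * c * (LINT s:{a..b}|lborel. ?h s) + \<epsilon>" if "\<epsilon> > 0" for \<epsilon>
  proof -
    have J: "J \<ge> 0" unfolding J_def set_lebesgue_integral_def by (rule Bochner_Integration.integral_nonneg) auto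
    \<comment> \<open>The 1 added to \<open>J\<close> keeps the denominator positive when
      \<open>J\<close> vanishes.\<close>
    define e where "e = \<epsilon> / (c * (J + 1))"
    have e: "e > 0" using J c that by (simp add: e_def)
    have "c * e * J = \<epsilon> * (J / (J+1))" using c by (simp add: e_def)
    also have "\<dots> \<le> \<epsilon> * 1" using that J by (intro mult_left_mono) auto
    finally have ce: "c * e * J \<le> \<epsilon>" by simp
    have "?l a b \<le> (LINT s:{a..b}|lborel. 2 * c * ?h s + c * e * cmod (\<gamma> s))" by (rule main[OF e])
    also have "\<dots> = 2 * c * (LINT s:{a..b}|lborel. ?h s) + c * e * J"
      unfolding J_def by (subst set_integral_add(2)) (use hint gint in \<open>auto intro!: set_integrable_mult_right\<close>)
    finally show ?thesis using ce by linarith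
  qed
  from field_le_epsilon[OF this] show ?thesis by (simp add: c_def)
qed

text \<open>Square integrability forces |v| to be arbitrarily small somewhere to the left of x:
  otherwise it would exceed a fixed e on a half-line of infinite measure. Starting the increment at
  such a point removes the boundary term.\<close>

lemma primitive_power_le_nn_integral:
  fixes v \<gamma> :: "real \<Rightarrow> complex"
  assumes [measurable]: "\<gamma> \<in> borel_measurable borel"
    and int: "\<And>a b. set_integrable lborel {a..b} \<gamma>"
    and eq: "\<And>a b. a \<le> b \<Longrightarrow> v b - v a = (LINT s:{a..b}|lborel. \<gamma> s)"
    and cont: "continuous_on UNIV v"
    and L2: "(\<integral>\<^sup>+s. ennreal ((cmod (v s))^2) \<partial>lborel) < \<infinity>"
  shows "ennreal (cmod (v x) ^ (k+2))
     \<le> ennreal (2 * real (k+1)) * (\<integral>\<^sup>+s. ennreal (cmod (v s)^k * \<bar>Re (cnj (v s) * \<gamma> s)\<bar>) \<partial>lborel)"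
    (is "_ \<le> _ * ?I")
proof -
  let ?h = "\<lambda>s. cmod (v s)^k * \<bar>Re (cnj (v s) * \<gamma> s)\<bar>"
  have [measurable]: "v \<in> borel_measurable borel" using cont by (rule borel_measurable_continuous_onI)
  have small: "\<exists>a\<le>x. cmod (v a) \<le> e" if "e > 0" for e
  proof (rule ccontr)
    assume "\<not> ?thesis"
    then have gt: "cmod (v a) > e" if "a \<le> x" for a using that not_le by blast
    have "ennreal (e^2) * emeasure lborel {..x} = (\<integral>\<^sup>+s. ennreal (e^2) * indicator {..x} s \<partial>lborel)"
      by (subst nn_integral_cmult_indicator) auto
    also have "\<dots> \<le> (\<integral>\<^sup>+s. ennreal ((cmod (v s))^2) \<partial>lborel)"
    proof (rule nn_integral_mono)
      fix s
      show "ennreal (e^2) * indicator {..x} s \<le> ennreal ((cmod (v s))^2)"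
      proof (cases "s \<le> x")
        case True
        then have "e^2 \<le> (cmod (v s))^2" using gt[of s] that by (intro power_mono) auto
        then show ?thesis using True by (simp add: ennreal_leI)
      qed simp
    qed
    also have "\<dots> < \<infinity>" by (rule L2)
    finally have "emeasure lborel {..x} < \<infinity>" using that
      by (auto simp: ennreal_mult_less_top)
    then obtain r where r: "emeasure lborel {..x} = ennreal r" "r \<ge> 0"
      by (auto simp: less_top_ennreal)
    have "ennreal (r + 1) = emeasure lborel {x - (r + 1)..x}" using r by simp
    also have "\<dots> \<le> emeasure lborel {..x}" by (rule emeasure_mono) auto
    finally show False using r by simp
  qed
  have "ennreal (cmod (v x) ^ (k+2)) \<le> ennreal (2 * real (k+1)) * ?I + ennreal e" if e: "e > 0" for e
  proof -
    \<comment> \<open>The cap at 1 gives e1^(k+2) \<le> e1.\<close>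
    define e1 where "e1 = min 1 e"
    have e1: "e1 > 0" "e1 \<le> 1" "e1 \<le> e" using e by (auto simp: e1_def)
    obtain a where a: "a \<le> x" "cmod (v a) \<le> e1" using small[OF e1(1)] by blast
    have "cmod (v a)^(k+2) \<le> e1^(k+2)" using a by (intro power_mono) auto
    also have "\<dots> \<le> e1" using e1 power_decreasing[of 1 "k+2" e1] by simp
    finally have va: "cmod (v a)^(k+2) \<le> e" using e1 by simp
    have nn: "(LINT s:{a..x}|lborel. ?h s) \<ge> 0"
      unfolding set_lebesgue_integral_def by (rule Bochner_Integration.integral_nonneg) auto
    have "ennreal (LINT s:{a..x}|lborel. ?h s) \<le> (\<integral>\<^sup>+s. ennreal (indicator {a..x} s *\<^sub>R ?h s) \<partial>lborel)"
    proof (cases "integrable lborel (\<lambda>s. indicator {a..x} s *\<^sub>R ?h s)")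
      case True
      then show ?thesis unfolding set_lebesgue_integral_def by (subst nn_integral_eq_integral) auto
    next
      case False
      then show ?thesis unfolding set_lebesgue_integral_def by (subst not_integrable_integral_eq) auto
    qed
    also have "\<dots> \<le> ?I" by (intro nn_integral_mono) (auto split: split_indicator)
    finally have I: "ennreal (LINT s:{a..x}|lborel. ?h s) \<le> ?I" .
    have "cmod (v x) ^ (k+2) \<le> 2 * real (k+1) * (LINT s:{a..x}|lborel. ?h s) + e"
      using primitive_power_le[OF int eq cont a(1), of k] va by linarith
    then have "ennreal (cmod (v x) ^ (k+2)) \<le> ennreal (2 * real (k+1) * (LINT s:{a..x}|lborel. ?h s) + e)"
      by (rule ennreal_leI)
    also have "\<dots> = ennreal (2 * real (k+1)) * ennreal (LINT s:{a..x}|lborel. ?h s) + ennreal e"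
      using nn e by (subst ennreal_plus) (auto simp: ennreal_mult)
    also have "\<dots> \<le> ennreal (2 * real (k+1)) * ?I + ennreal e"
      using I by (rule add_right_mono[OF mult_left_mono]) simp
    finally show ?thesis .
  qed
  then show ?thesis using ennreal_le_epsilon by blast
qed

subsection \<open>The fundamental lemma of the calculus of variations\<close>

text \<open>Each factor is squared because the square of a positive part is continuously
  differentiable, the positive part itself not.\<close>

definition bump_num :: "real^2 \<Rightarrow> real^2 \<Rightarrow> real^2 \<Rightarrow> real" where
  "bump_num a b x = (max 0 ((x$1 - a$1) * (b$1 - x$1)))\<^sup>2 * (max 0 ((x$2 - a$2) * (b$2 - x$2)))\<^sup>2"

text \<open>For fixed r \<ge> 0, n r / (1 + n r) lies in [0, 1), tends to 1 if r > 0 and is 0 if r =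
  0. This yields test functions that converge to the indicator of an open box from below, with no
  exponential bump.\<close>

definition bump :: "nat \<Rightarrow> real^2 \<Rightarrow> real^2 \<Rightarrow> real^2 \<Rightarrow> real" where
  "bump n a b x = real n * bump_num a b x / (1 + real n * bump_num a b x)"

text \<open>The first-order remainder is at most h^2 for every combination of signs of x and x + h,
  which includes the corner x = 0.\<close>

lemma has_real_derivative_pos_square:
  "((\<lambda>t::real. (max 0 t)\<^sup>2) has_real_derivative 2 * max 0 x) (at x)"
proof -
  have le: "\<bar>(max 0 (x+h))\<^sup>2 - (max 0 x)\<^sup>2 - 2 * max 0 x * h\<bar> \<le> h\<^sup>2" for h
  proof -
    consider "x \<ge> 0" "x+h \<ge> 0" | "x \<ge> 0" "x+h < 0" | "x < 0" "x+h \<ge> 0" | "x<0" "x+h<0" by linarith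
    then show ?thesis
    proof cases
      case 2
      have "0 \<le> (x+h)\<^sup>2" "x * (x+h) \<le> 0" "x * h \<le> 0" using 2 by (auto simp: mult_le_0_iff)
      then have "\<bar>- (x*x) - 2 * x * h\<bar> \<le> h*h"
        by (simp add: abs_le_iff power2_eq_square algebra_simps)
      then show ?thesis using 2 by (simp add: max_def power2_eq_square)
    next
      case 3
      then have "(x+h)\<^sup>2 \<le> h\<^sup>2" by (intro power_mono) auto
      then show ?thesis using 3 by (simp add: max_def)
    qed (simp_all add: max_def power2_eq_square algebra_simps)
  qed
  have "((\<lambda>h. ((max 0 (x+h))\<^sup>2 - (max 0 x)\<^sup>2) / h - 2 * max 0 x) \<longlongrightarrow> 0) (at 0)"
  proof (rule Lim_null_comparison)
    show "\<forall>\<^sub>F h in at 0. norm (((max 0 (x+h))\<^sup>2 - (max 0 x)\<^sup>2) / h - 2 * max 0 x) \<le> \<bar>h\<bar>"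
    proof (rule eventually_at_filter[THEN iffD2], rule always_eventually, intro allI impI)
      fix h :: real assume h: "h \<noteq> 0"
      have "((max 0 (x+h))\<^sup>2 - (max 0 x)\<^sup>2) / h - 2 * max 0 x
         = ((max 0 (x+h))\<^sup>2 - (max 0 x)\<^sup>2 - 2 * max 0 x * h) / h" using h by (simp add: field_simps)
      also have "\<bar>\<dots>\<bar> \<le> h\<^sup>2 / \<bar>h\<bar>" using le[of h] by (simp add: abs_divide divide_right_mono)
      also have "\<dots> = \<bar>h\<bar>" using h by (simp add: field_simps power2_eq_square flip: abs_mult)
      finally show "norm (((max 0 (x+h))\<^sup>2 - (max 0 x)\<^sup>2) / h - 2 * max 0 x) \<le> \<bar>h\<bar>" by simp
    qed
    show "((\<lambda>h::real. \<bar>h\<bar>) \<longlongrightarrow> 0) (at 0)" by (rule tendsto_eq_intros refl | simp)+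
  qed
  then show ?thesis unfolding DERIV_def by (rule LIM_zero_cancel)
qed

lemma test_funI:
  assumes "\<And>j x. ((\<lambda>t. \<psi> (x + t *\<^sub>R axis j 1)) has_real_derivative d j x) (at 0)"
    and "\<And>j. continuous_on UNIV (d j)" and "\<And>x. \<psi> x \<noteq> 0 \<Longrightarrow> x \<in> B" and "bounded B"
  shows "test_fun \<psi>"
proof -
  have p: "partial j \<psi> = d j" for j
    unfolding partial_def using assms(1) by (auto intro: DERIV_imp_deriv)
  have "bounded {x. \<psi> x \<noteq> 0}" using assms(3,4) by (auto intro: bounded_subset)
  then show ?thesis
    unfolding test_fun_def p using assms by (simp add: compact_closure)
qed

lemma bump_num_nonneg: "bump_num a b x \<ge> 0" by (simp add: bump_num_def)

text \<open>Nonemptiness excludes reversed corners: for u < l the product (t - l) * (u - t) would be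
  positive between u and l.\<close>

lemma bump_num_pos_iff:
  assumes "box a b \<noteq> {}"
  shows "bump_num a b x > 0 \<longleftrightarrow> x \<in> box a b"
proof -
  have *: "(max 0 ((t - l) * (u - t)))\<^sup>2 > 0 \<longleftrightarrow> l < t \<and> t < u" if "l < u" for t l u :: real
  proof -
    have "(max 0 ((t - l) * (u - t)))\<^sup>2 > 0 \<longleftrightarrow> (t - l) * (u - t) > 0"
      by (cases "(t - l) * (u - t) > 0") (auto simp: max_def)
    also have "\<dots> \<longleftrightarrow> l < t \<and> t < u"
      using that by (simp add: zero_less_mult_iff) linarith
    finally show ?thesis .
  qed
  obtain y where "y \<in> box a b" using assms by blast
  then have ab: "a $ i < b $ i" for i by (auto simp: mem_box_cart intro: less_trans)
  have "bump_num a b x > 0 \<longleftrightarrow>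
     (max 0 ((x$1 - a$1) * (b$1 - x$1)))\<^sup>2 > 0 \<and> (max 0 ((x$2 - a$2) * (b$2 - x$2)))\<^sup>2 > 0"
    unfolding bump_num_def zero_less_mult_iff using not_less[THEN iffD2, OF zero_le_power2] by blast
  then show ?thesis using *[OF ab[of 1]] *[OF ab[of 2]] by (simp only: mem_box_cart forall_2)
qed

lemma test_fun_bump:
  assumes "box a b \<noteq> {}"
  shows "test_fun (bump n a b)"
proof (rule test_funI)
  fix j :: 2 and x :: "real^2"
  define \<tau> where "\<tau> = (\<lambda>i x. (x$i - a$i) * (b$i - x$i))"
  define \<delta> where "\<delta> = (\<lambda>i (x::real^2). axis j 1 $ i * (b$i - x$i) - (x$i - a$i) * axis j 1 $ i)"
  have 1: "((\<lambda>t. (max 0 (\<tau> i (x + t *\<^sub>R axis j 1)))\<^sup>2) has_real_derivative 2 * max 0 (\<tau> i x) * \<delta> i x) (at 0)" for i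
  proof (rule DERIV_chain2[where f = "\<lambda>t. (max 0 t)\<^sup>2" and g = "\<lambda>t. \<tau> i (x + t *\<^sub>R axis j 1)"])
    show "((\<lambda>t. (max 0 t)\<^sup>2) has_real_derivative 2 * max 0 (\<tau> i x)) (at (\<tau> i (x + 0 *\<^sub>R axis j 1)))"
      using has_real_derivative_pos_square[of "\<tau> i x"] by simp
    show "((\<lambda>t. \<tau> i (x + t *\<^sub>R axis j 1)) has_real_derivative \<delta> i x) (at 0)"
      unfolding \<tau>_def \<delta>_def by (auto intro!: derivative_eq_intros)
  qed
  define dm where "dm = (\<lambda>x. (2 * max 0 (\<tau> 1 x) * \<delta> 1 x) * (max 0 (\<tau> 2 x))\<^sup>2 + (2 * max 0 (\<tau> 2 x) * \<delta> 2 x) * (max 0 (\<tau> 1 x))\<^sup>2)"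
  have bm: "bump_num a b = (\<lambda>x. (max 0 (\<tau> 1 x))\<^sup>2 * (max 0 (\<tau> 2 x))\<^sup>2)"
    by (auto simp: bump_num_def \<tau>_def)
  have 2: "((\<lambda>t. bump_num a b (x + t *\<^sub>R axis j 1)) has_real_derivative dm x) (at 0)"
    unfolding bm dm_def using DERIV_mult[OF 1[of 1] 1[of 2]] by simp
  have pos: "1 + real n * bump_num a b x > 0" for x using bump_num_nonneg[of a b x] by (simp add: add_pos_nonneg)
  define M where "M = bump_num a b x"
  define N where "N = real n"
  have Mp: "1 + N * M > 0" using pos[of x] by (simp add: M_def N_def)
  have eq: "(N * dm x * (1 + N * M) - N * M * (N * dm x)) / ((1 + N * M) * (1 + N * M)) = N * dm x / (1 + N * M)\<^sup>2"
    by (simp add: algebra_simps power2_eq_square)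
  have "((\<lambda>t. bump n a b (x + t *\<^sub>R axis j 1)) has_real_derivative
     (N * dm x * (1 + N * M) - N * M * (N * dm x)) / ((1 + N * M) * (1 + N * M))) (at 0)"
    unfolding bump_def
    using Mp by (auto intro!: derivative_eq_intros 2 simp: M_def N_def)
  then show "((\<lambda>t. bump n a b (x + t *\<^sub>R axis j 1)) has_real_derivative
    (\<lambda>j x. real n * ((2 * max 0 ((x$1 - a$1) * (b$1 - x$1)) * (axis j 1 $ 1 * (b$1 - x$1) - (x$1 - a$1) * axis j 1 $ 1))
          * (max 0 ((x$2 - a$2) * (b$2 - x$2)))\<^sup>2
        + (2 * max 0 ((x$2 - a$2) * (b$2 - x$2)) * (axis j 1 $ 2 * (b$2 - x$2) - (x$2 - a$2) * axis j 1 $ 2))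
          * (max 0 ((x$1 - a$1) * (b$1 - x$1)))\<^sup>2) / (1 + real n * bump_num a b x)\<^sup>2) j x) (at 0)"
    unfolding eq unfolding dm_def \<tau>_def \<delta>_def N_def M_def .
next
  fix j
  have pos: "1 + real n * bump_num a b x \<noteq> 0" for x
    using add_pos_nonneg[OF zero_less_one mult_nonneg_nonneg[OF of_nat_0_le_iff bump_num_nonneg[of a b x]], of n] by simp
  show "continuous_on UNIV ((\<lambda>j x. real n * ((2 * max 0 ((x$1 - a$1) * (b$1 - x$1)) * (axis j 1 $ 1 * (b$1 - x$1) - (x$1 - a$1) * axis j 1 $ 1))
          * (max 0 ((x$2 - a$2) * (b$2 - x$2)))\<^sup>2
        + (2 * max 0 ((x$2 - a$2) * (b$2 - x$2)) * (axis j 1 $ 2 * (b$2 - x$2) - (x$2 - a$2) * axis j 1 $ 2))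
          * (max 0 ((x$1 - a$1) * (b$1 - x$1)))\<^sup>2) / (1 + real n * bump_num a b x)\<^sup>2) j)"
    using pos unfolding bump_num_def by (auto intro!: continuous_intros)
next
  fix x assume "bump n a b x \<noteq> 0"
  then have "bump_num a b x > 0" using bump_num_nonneg[of a b x] by (cases "bump_num a b x = 0") (auto simp: bump_def)
  then show "x \<in> box a b" by (simp add: bump_num_pos_iff[OF assms])
qed (rule bounded_box)

lemma bump_bounds:
  assumes "box a b \<noteq> {}"
  shows "0 \<le> bump n a b x" "bump n a b x \<le> indicator (box a b) x"
proof -
  show "0 \<le> bump n a b x" using bump_num_nonneg[of a b x] by (simp add: bump_def)
  show "bump n a b x \<le> indicator (box a b) x"
  proof (cases "x \<in> box a b")
    case True
    then show ?thesis using bump_num_nonneg[of a b x] by (simp add: bump_def divide_le_eq_1 add_pos_nonneg)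
  next
    case False
    then have "bump_num a b x = 0" using bump_num_pos_iff[OF assms, of x] bump_num_nonneg[of a b x] by auto
    then show ?thesis by (simp add: bump_def)
  qed
qed

lemma bump_tendsto:
  assumes "box a b \<noteq> {}"
  shows "(\<lambda>n. bump n a b x) \<longlonglongrightarrow> indicator (box a b) x"
proof (cases "x \<in> box a b")
  case True
  define m where "m = bump_num a b x"
  have m: "m > 0" using True by (simp add: m_def bump_num_pos_iff[OF assms])
  have "(\<lambda>n. 1 - 1 / (1 + real n * m)) \<longlonglongrightarrow> 1 - 0"
  proof (intro tendsto_diff tendsto_const tendsto_divide_0[OF tendsto_const] filterlim_at_top_imp_at_infinity)
    show "filterlim (\<lambda>n. 1 + real n * m) at_top sequentially"
      using m by (intro filterlim_tendsto_add_at_top[OF tendsto_const] filterlim_at_top_mult_tendsto_pos[OF tendsto_const _ filterlim_real_sequentially]) auto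
  qed
  moreover have "1 - 1 / (1 + real n * m) = bump n a b x" for n
  proof -
    have "1 + real n * m > 0" using m by (simp add: add_pos_nonneg)
    then show ?thesis by (simp add: bump_def m_def[symmetric] field_simps)
  qed
  ultimately show ?thesis using True by simp
next
  case False
  have "bump n a b x = 0" for n using bump_bounds[OF assms, of n x] False by simp
  then show ?thesis using False by simp
qed

lemma bump_measurable [measurable]: "bump n a b \<in> borel_measurable borel"
  unfolding bump_def bump_num_def by measurable

lemma Int_stable_boxes: "Int_stable (range (\<lambda>(a, b). box a b :: 'a::euclidean_space set))"
  by (auto simp: Int_stable_def box_Int_box)

text \<open>Dominated convergence along the bumps makes the integral over every box vanish. Boxes
  generate the Borel sets and are stable under intersection, so the integrals over all Borel sets
  vanish too.\<close>

lemma AE_zero_if_test_integrals_zero: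
  fixes f :: "real^2 \<Rightarrow> complex"
  assumes [measurable]: "f \<in> borel_measurable borel"
    and int: "\<And>a b. set_integrable lborel (box a b) f"
    and zero: "\<And>\<psi>. test_fun \<psi> \<Longrightarrow> (LINT x|lborel. f x * complex_of_real (\<psi> x)) = 0"
  shows "AE x in lborel. f x = 0"
proof -
  have box: "(LINT x:box a b|lborel. f x) = 0" for a b
  proof (cases "box a b = {}")
    case True
    then show ?thesis by (simp add: set_lebesgue_integral_def)
  next
    case ne: False
    have "(\<lambda>n. LINT x|lborel. f x * complex_of_real (bump n a b x)) \<longlonglongrightarrow> (LINT x|lborel. indicator (box a b) x *\<^sub>R f x)"
    proof (rule integral_dominated_convergence)
      show "integrable lborel (\<lambda>x. norm (indicator (box a b) x *\<^sub>R f x))"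
        using int[of a b] unfolding set_integrable_def by (rule integrable_norm)
      show "AE x in lborel. (\<lambda>n. f x * complex_of_real (bump n a b x)) \<longlonglongrightarrow> indicator (box a b) x *\<^sub>R f x"
      proof (rule AE_I2)
        fix x
        have "(\<lambda>n. f x * complex_of_real (bump n a b x)) \<longlonglongrightarrow> f x * complex_of_real (indicator (box a b) x)"
          by (intro tendsto_intros bump_tendsto ne)
        then show "(\<lambda>n. f x * complex_of_real (bump n a b x)) \<longlonglongrightarrow> indicator (box a b) x *\<^sub>R f x"
          by (simp add: scaleR_conv_of_real mult.commute)
      qed
      show "AE x in lborel. norm (f x * complex_of_real (bump n a b x)) \<le> norm (indicator (box a b) x *\<^sub>R f x)" for n
      proof (rule AE_I2)
        fix x
        show "norm (f x * complex_of_real (bump n a b x)) \<le> norm (indicator (box a b) x *\<^sub>R f x)"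
          using bump_bounds[OF ne, of n x] by (simp add: norm_mult mult.commute[of _ "cmod (f x)"] mult_left_mono)
      qed
    qed auto
    then show ?thesis
      using zero[OF test_fun_bump[OF ne]] by (simp add: set_lebesgue_integral_def LIMSEQ_const_iff)
  qed
  \<comment> \<open>\<open>density_zero\<close> asks for a function integrable over the whole plane,
    while f is only locally integrable; hence f is first cut off to a single box.\<close>
  have "AE x in lborel. indicator (box a b) x *\<^sub>R f x = 0" for a b
  proof (rule sigma_finite_measure.density_zero[OF sigma_finite_lborel])
    show i: "integrable lborel (\<lambda>x. indicator (box a b) x *\<^sub>R f x)"
      using int unfolding set_integrable_def .
    have i': "set_integrable lborel A (\<lambda>x. indicator (box a b) x *\<^sub>R f x)" if "A \<in> sets borel" for A
      unfolding set_integrable_def by (rule integrable_mult_indicator) (use i that in simp_all)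
    fix A :: "(real^2) set" assume "A \<in> sets lborel"
    then have "A \<in> sigma_sets UNIV (range (\<lambda>(a, b). box a b))" by (simp add: borel_eq_box)
    note Int_stable_boxes subset_UNIV[of "range (\<lambda>(a, b). box a b :: (real^2) set)", folded Pow_UNIV] this
    then show "(LINT x:A|lborel. indicator (box a b) x *\<^sub>R f x) = 0"
    proof (induction rule: sigma_sets_induct_disjoint)
      case (basic A)
      then obtain c d where A: "A = box c d" by auto
      obtain p q where pq: "box c d \<inter> box a b = box p q" using box_Int_box[of c d a b] by blast
      have "(LINT x:A|lborel. indicator (box a b) x *\<^sub>R f x) = (LINT x:(box c d \<inter> box a b)|lborel. f x)"
        unfolding set_lebesgue_integral_def A by (simp add: indicator_inter_arith)
      then show ?case by (simp add: pq box)
    next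
      case empty
      then show ?case by (simp add: set_lebesgue_integral_def)
    next
      case (compl A)
      then have [measurable]: "A \<in> sets borel" by (simp add: borel_eq_box)
      have "(LINT x:UNIV - A|lborel. indicator (box a b) x *\<^sub>R f x)
        = (LINT x|lborel. indicator (box a b) x *\<^sub>R f x) - (LINT x:A|lborel. indicator (box a b) x *\<^sub>R f x)"
      proof -
        have "indicator (UNIV - A) x *\<^sub>R indicator (box a b) x *\<^sub>R f x
          = indicator (box a b) x *\<^sub>R f x - indicat_real A x *\<^sub>R indicator (box a b) x *\<^sub>R f x" for x
          by (cases "x \<in> A") auto
        then show ?thesis
          unfolding set_lebesgue_integral_def
          using Bochner_Integration.integral_diff[OF i i'[unfolded set_integrable_def, of A]] by simp
      qed
      then show ?case using box[of a b] compl by (simp add: set_lebesgue_integral_def)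
    next
      case (union A)
      then have m: "\<And>i. A i \<in> sets borel" by (auto simp: borel_eq_box)
      then have "set_integrable lborel (\<Union>i. A i) (\<lambda>x. indicator (box a b) x *\<^sub>R f x)" by (intro i') auto
      then have "(LINT x:(\<Union>i. A i)|lborel. indicator (box a b) x *\<^sub>R f x)
          = (\<Sum>i. (LINT x:A i|lborel. indicator (box a b) x *\<^sub>R f x))"
        using m union(1) by (intro lebesgue_integral_countable_add) (auto simp: disjoint_family_on_def)
      then show ?case using union by simp
    qed
  qed
  then have "AE x in lborel. \<forall>n::nat. indicator (box (vec (-real n)) (vec (real n))) x *\<^sub>R f x = 0"
    by (intro AE_all_countable[THEN iffD2] allI)
  then show ?thesis
  proof eventually_elim
    case (elim x)
    obtain n :: nat where n: "norm x < n" using reals_Archimedean2 by blast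
    have "\<bar>x $ i\<bar> < n" for i using component_le_norm_cart[of x i] n by linarith
    then have "x \<in> box (vec (-real n)) (vec (real n))" by (auto simp: mem_box_cart abs_less_iff minus_less_iff)
    then show ?case using elim[rule_format, of n] by simp
  qed
qed

subsection \<open>Square-integrable functions and test functions\<close>

text \<open>The notion behind \<open>sq_int\<close>, for any Euclidean domain, so that it also
  covers restrictions to lines; the nonnegative integral suits Tonelli.\<close>

definition l2 :: "('a::euclidean_space \<Rightarrow> complex) \<Rightarrow> bool" where
  "l2 f \<longleftrightarrow> f \<in> borel_measurable borel \<and> (\<integral>\<^sup>+x. ennreal ((cmod (f x))\<^sup>2) \<partial>lborel) < \<infinity>"

lemma l2_measurable [measurable_dest]: "l2 f \<Longrightarrow> f \<in> borel_measurable borel"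
  by (simp add: l2_def)

lemma sq_int_iff_l2: "sq_int f \<longleftrightarrow> l2 f"
  by (auto simp: sq_int_def l2_def integrable_iff_bounded)

lemma nn_integral_translate:
  fixes f :: "'a::euclidean_space \<Rightarrow> ennreal"
  assumes [measurable]: "f \<in> borel_measurable borel"
  shows "(\<integral>\<^sup>+x. f (x + a) \<partial>lborel) = (\<integral>\<^sup>+x. f x \<partial>lborel)"
  by (subst (2) lborel_distr_plus[of a, symmetric]) (simp add: nn_integral_distr add.commute)

lemma l2_translate: "l2 f \<Longrightarrow> l2 (\<lambda>x. f (x + a))"
  unfolding l2_def using nn_integral_translate[of "\<lambda>x. ennreal ((cmod (f x))\<^sup>2)" a] by auto

lemma integral_translate:
  fixes f :: "'a::euclidean_space \<Rightarrow> 'b::{banach, second_countable_topology}"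
  assumes [measurable]: "f \<in> borel_measurable borel"
  shows "(LINT x|lborel. f (x + a)) = (LINT x|lborel. f x)"
  by (subst (2) lborel_distr_plus[of a, symmetric]) (simp add: integral_distr add.commute)

lemma norm_mult_le_squares: "ennreal (cmod (a * b)) \<le> ennreal ((cmod a)\<^sup>2) + ennreal ((cmod b)\<^sup>2)"
proof -
  have "cmod a * cmod b \<le> 1 * (cmod a)\<^sup>2 + (cmod b)\<^sup>2"
    using sum_squares_bound[of "cmod a" "cmod b"] mult_nonneg_nonneg[OF norm_ge_zero[of a] norm_ge_zero[of b]] by linarith
  then show ?thesis by (simp add: norm_mult ennreal_leI flip: ennreal_plus)
qed

lemma l2_integrable_mult:
  assumes "l2 f" "l2 g" shows "integrable lborel (\<lambda>x. f x * g x)"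
proof (rule integrableI_bounded)
  note [measurable] = assms[THEN l2_measurable]
  show "(\<lambda>x. f x * g x) \<in> borel_measurable lborel" by measurable
  have "(\<integral>\<^sup>+x. ennreal (cmod (f x * g x)) \<partial>lborel) \<le> (\<integral>\<^sup>+x. ennreal ((cmod (f x))\<^sup>2) + ennreal ((cmod (g x))\<^sup>2) \<partial>lborel)"
    by (intro nn_integral_mono norm_mult_le_squares)
  also have "\<dots> < \<infinity>" using assms by (subst nn_integral_add) (auto simp: l2_def)
  finally show "(\<integral>\<^sup>+x. ennreal (cmod (f x * g x)) \<partial>lborel) < \<infinity>" .
qed

lemma l2_bounded_support:
  fixes f :: "'a::euclidean_space \<Rightarrow> complex"
  assumes [measurable]: "f \<in> borel_measurable borel"
    and "\<And>x. cmod (f x) \<le> M" "\<And>x. f x \<noteq> 0 \<Longrightarrow> x \<in> B" "bounded B"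
  shows "l2 f"
proof -
  obtain r where r: "\<And>x. x \<in> B \<Longrightarrow> norm x < r"
    using \<open>bounded B\<close> unfolding bounded_pos_less by blast
  have M: "M \<ge> 0" using assms(2)[of undefined] norm_ge_zero order_trans by blast
  have "(\<integral>\<^sup>+x. ennreal ((cmod (f x))\<^sup>2) \<partial>lborel) \<le> (\<integral>\<^sup>+x. ennreal (M\<^sup>2) * indicator (ball (0::'a) r) x \<partial>lborel)"
  proof (rule nn_integral_mono)
    fix x
    show "ennreal ((cmod (f x))\<^sup>2) \<le> ennreal (M\<^sup>2) * indicator (ball 0 r) x"
      using r assms(3)[of x] power_mono[OF assms(2)[of x] norm_ge_zero, of 2]
      by (cases "f x = 0") (auto intro: ennreal_leI)
  qed
  also have "\<dots> = ennreal (M\<^sup>2) * emeasure lborel (ball (0::'a) r)"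
    by (rule nn_integral_cmult_indicator) simp
  also have "\<dots> < \<infinity>" using emeasure_lborel_ball_finite[of "0::'a" r] by (simp add: ennreal_mult_less_top)
  finally show ?thesis by (simp add: l2_def)
qed

lemma l2_indicator: "bounded (B :: (real^2) set) \<Longrightarrow> B \<in> sets borel \<Longrightarrow> l2 (\<lambda>x. of_real (indicator B x))"
  by (rule l2_bounded_support[of _ 1 B]) (auto split: split_indicator_asm split_indicator)

lemma has_real_derivative_partial:
  assumes "test_fun \<psi>"
  shows "((\<lambda>t. \<psi> (x + t *\<^sub>R axis j 1)) has_real_derivative partial j \<psi> (x + s *\<^sub>R axis j 1)) (at s)"
proof -
  have "((\<lambda>t. \<psi> ((x + s *\<^sub>R axis j 1) + t *\<^sub>R axis j 1)) has_real_derivative partial j \<psi> (x + s *\<^sub>R axis j 1)) (at 0)"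
    using assms unfolding test_fun_def by blast
  then have "((\<lambda>t. \<psi> ((x + s *\<^sub>R axis j 1) + (t - s) *\<^sub>R axis j 1)) has_real_derivative partial j \<psi> (x + s *\<^sub>R axis j 1)) (at (0 + s))"
    using DERIV_shift[of "\<lambda>t. \<psi> ((x + s *\<^sub>R axis j 1) + (t - s) *\<^sub>R axis j 1)" "partial j \<psi> (x + s *\<^sub>R axis j 1)" 0 s] by simp
  then show ?thesis by (simp add: algebra_simps)
qed

lemma partial_translate: "partial j (\<lambda>x. \<psi> (x + a)) = (\<lambda>x. partial j \<psi> (x + a))"
  by (rule ext) (simp add: partial_def add.assoc add.commute[of _ a])

lemma test_fun_translate:
  assumes "test_fun \<psi>" shows "test_fun (\<lambda>x. \<psi> (x + a))"
proof -
  have 1: "((\<lambda>t. \<psi> (x + t *\<^sub>R axis j 1 + a)) has_real_derivative partial j \<psi> (x + a)) (at 0)" for j x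
  proof -
    have "((\<lambda>t. \<psi> ((x + a) + t *\<^sub>R axis j 1)) has_real_derivative partial j \<psi> (x + a)) (at 0)"
      using assms unfolding test_fun_def by blast
    moreover have "(\<lambda>t. \<psi> ((x + a) + t *\<^sub>R axis j 1)) = (\<lambda>t. \<psi> (x + t *\<^sub>R axis j 1 + a))"
      by (simp add: algebra_simps)
    ultimately show ?thesis by simp
  qed
  have 2: "continuous_on UNIV (\<lambda>x. partial j \<psi> (x + a))" for j
  proof -
    have "continuous_on UNIV (partial j \<psi>)" using assms unfolding test_fun_def by blast
    then show ?thesis by (rule continuous_on_compose2) (auto intro!: continuous_intros)
  qed
  have "bounded {x. \<psi> x \<noteq> 0}" using assms unfolding test_fun_def by simp
  then have "bounded ((\<lambda>x. - a + x) ` {x. \<psi> x \<noteq> 0})" by (rule bounded_translation)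
  moreover have "{x. \<psi> (x + a) \<noteq> 0} \<subseteq> (\<lambda>x. - a + x) ` {x. \<psi> x \<noteq> 0}"
  proof
    fix x assume "x \<in> {x. \<psi> (x + a) \<noteq> 0}"
    then show "x \<in> (\<lambda>x. - a + x) ` {x. \<psi> x \<noteq> 0}" by (intro image_eqI[of _ _ "x + a"]) auto
  qed
  ultimately have "bounded {x. \<psi> (x + a) \<noteq> 0}" by (rule bounded_subset)
  then show ?thesis using 1 2 unfolding test_fun_def partial_translate by simp
qed

lemma continuous_bounded_on_compact:
  fixes f :: "'a::topological_space \<Rightarrow> real"
  assumes "continuous_on UNIV f" "compact K"
  obtains M where "\<And>x. x \<in> K \<Longrightarrow> \<bar>f x\<bar> \<le> M"
proof -
  have "compact (f ` K)"
    using assms by (intro compact_continuous_image) (auto intro: continuous_on_subset)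
  then have "bounded (f ` K)" by (rule compact_imp_bounded)
  then obtain M where "\<forall>y\<in>f ` K. norm y \<le> M" unfolding bounded_iff by blast
  then show ?thesis using that by auto
qed

lemma partial_eq_0_outside:
  assumes "test_fun \<psi>" "x \<notin> closure {x. \<psi> x \<noteq> 0}" shows "partial j \<psi> x = 0"
proof -
  have "open (- closure {x. \<psi> x \<noteq> 0})" by auto
  then obtain e where e: "e > 0" "\<And>y. dist y x < e \<Longrightarrow> y \<notin> closure {x. \<psi> x \<noteq> 0}"
    using assms(2) unfolding open_dist by blast
  have "((\<lambda>t. 0::real) has_real_derivative partial j \<psi> x) (at 0)"
  proof (rule has_field_derivative_transform_within[where d = e])
    show "((\<lambda>t. \<psi> (x + t *\<^sub>R axis j 1)) has_real_derivative partial j \<psi> x) (at 0)" using assms unfolding test_fun_def by blast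
    fix t :: real assume "dist t 0 < e"
    then have "dist (x + t *\<^sub>R axis j 1) x < e" by (simp add: dist_norm)
    from e(2)[OF this] show "\<psi> (x + t *\<^sub>R axis j 1) = 0" using closure_subset[of "{x. \<psi> x \<noteq> 0}"] by auto
  qed (use e in auto)
  then show ?thesis using DERIV_const DERIV_unique by blast
qed

lemma bounded_partial:
  assumes "test_fun \<psi>" obtains M where "M \<ge> 0" "\<And>x. \<bar>partial j \<psi> x\<bar> \<le> M"
proof -
  have "continuous_on UNIV (partial j \<psi>)" "compact (closure {x. \<psi> x \<noteq> 0})"
    using assms by (simp_all add: test_fun_def)
  then obtain M where M: "\<And>x. x \<in> closure {x. \<psi> x \<noteq> 0} \<Longrightarrow> \<bar>partial j \<psi> x\<bar> \<le> M"
    using continuous_bounded_on_compact by blast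
  show ?thesis
  proof
    show "\<bar>partial j \<psi> x\<bar> \<le> max M 0" for x using M[of x] partial_eq_0_outside[OF assms, of x j] by fastforce
  qed simp
qed

text \<open>A \<open>test_fun\<close> is only assumed to have continuous partial derivatives, so its own continuity has
  to be derived, by joining two points along a path parallel to the axes.\<close>

lemma test_fun_lipschitz_axis:
  assumes "test_fun \<psi>" "\<And>x. \<bar>partial j \<psi> x\<bar> \<le> M"
  shows "\<bar>\<psi> (x + t *\<^sub>R axis j 1) - \<psi> x\<bar> \<le> M * \<bar>t\<bar>"
proof -
  have "norm (\<psi> (x + t *\<^sub>R axis j 1) - \<psi> (x + 0 *\<^sub>R axis j 1)) \<le> M * norm (t - 0)"
    by (rule field_differentiable_bound[of UNIV "\<lambda>t. \<psi> (x + t *\<^sub>R axis j 1)" "\<lambda>t. partial j \<psi> (x + t *\<^sub>R axis j 1)"])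
       (use assms has_real_derivative_partial[OF assms(1)] in auto)
  then show ?thesis by simp
qed

lemma continuous_test_fun:
  assumes "test_fun \<psi>" shows "continuous_on UNIV \<psi>"
proof -
  obtain M1 where M1: "M1 \<ge> 0" "\<And>x. \<bar>partial 1 \<psi> x\<bar> \<le> M1" using bounded_partial[OF assms] by blast
  obtain M2 where M2: "M2 \<ge> 0" "\<And>x. \<bar>partial 2 \<psi> x\<bar> \<le> M2" using bounded_partial[OF assms] by blast
  have lip: "dist (\<psi> x) (\<psi> y) \<le> (M1 + M2) * dist x y" for x y
  proof -
    define z where "z = y + (x$1 - y$1) *\<^sub>R axis 1 1"
    have x: "x = z + (x$2 - y$2) *\<^sub>R axis 2 1"
      by (simp add: vec_eq_iff forall_2 z_def axis_def)
    have "\<bar>\<psi> x - \<psi> y\<bar> \<le> \<bar>\<psi> z - \<psi> y\<bar> + \<bar>\<psi> x - \<psi> z\<bar>" by linarith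
    also have "\<dots> \<le> M1 * \<bar>x$1 - y$1\<bar> + M2 * \<bar>x$2 - y$2\<bar>"
      using test_fun_lipschitz_axis[OF assms M1(2), of y "x$1 - y$1"] test_fun_lipschitz_axis[OF assms M2(2), of z "x$2 - y$2"]
      by (simp flip: x z_def)
    also have "\<dots> \<le> M1 * dist x y + M2 * dist x y"
      using M1 M2 dist_vec_nth_le[of x _ y] by (intro add_mono mult_left_mono) (auto simp: dist_real_def)
    finally show ?thesis by (simp add: dist_real_def distrib_right)
  qed
  have "(M1 + M2)-lipschitz_on UNIV \<psi>" using lip M1 M2 by (intro lipschitz_onI) auto
  then show ?thesis by (rule lipschitz_on_continuous_on)
qed

lemma test_fun_l2:
  assumes "test_fun \<psi>"
  shows "l2 (\<lambda>x. of_real (\<psi> x))" "l2 (\<lambda>x. of_real (partial j \<psi> x))"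
proof -
  have K: "compact (closure {x. \<psi> x \<noteq> 0})" using assms by (simp add: test_fun_def)
  then have B: "bounded (closure {x. \<psi> x \<noteq> 0})" by (rule compact_imp_bounded)
  have "continuous_on UNIV (\<lambda>x. complex_of_real (\<psi> x))" using continuous_test_fun[OF assms] by (intro continuous_intros)
  then have m [measurable]: "(\<lambda>x. complex_of_real (\<psi> x)) \<in> borel_measurable borel" by (rule borel_measurable_continuous_onI)
  obtain M where M: "\<And>x. x \<in> closure {x. \<psi> x \<noteq> 0} \<Longrightarrow> \<bar>\<psi> x\<bar> \<le> M"
    using continuous_bounded_on_compact[OF continuous_test_fun[OF assms] K] by blast
  show "l2 (\<lambda>x. of_real (\<psi> x))"
  proof (rule l2_bounded_support[OF m _ _ B])
    fix x
    have c: "x \<in> closure {x. \<psi> x \<noteq> 0}" if "\<psi> x \<noteq> 0" using that closure_subset[of "{x. \<psi> x \<noteq> 0}"] by auto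
    show "cmod (of_real (\<psi> x)) \<le> max M 0" using M[of x] c by (cases "\<psi> x = 0") auto
    show "of_real (\<psi> x) \<noteq> (0::complex) \<Longrightarrow> x \<in> closure {x. \<psi> x \<noteq> 0}" using c by simp
  qed
  have "continuous_on UNIV (\<lambda>x. complex_of_real (partial j \<psi> x))" using assms by (intro continuous_intros) (simp add: test_fun_def)
  then have m [measurable]: "(\<lambda>x. complex_of_real (partial j \<psi> x)) \<in> borel_measurable borel" by (rule borel_measurable_continuous_onI)
  obtain M where M: "\<And>x. \<bar>partial j \<psi> x\<bar> \<le> M" using bounded_partial[OF assms] by blast
  show "l2 (\<lambda>x. of_real (partial j \<psi> x))"
    using M partial_eq_0_outside[OF assms] by (intro l2_bounded_support[OF m _ _ B]) auto
qed

subsection \<open>Absolute continuity of weakly differentiable functions on lines\<close>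

text \<open>Supplies the Fubini hypothesis for the next lemma. By |f k| \<le> |f|^2 + |k|^2 and
  translation invariance, the inner integral over x is bounded uniformly in the shift. Two separate
  shifts are allowed because one use moves the test function and another moves g.\<close>

lemma shift_product_integrable:
  fixes f k :: "real^2 \<Rightarrow> complex"
  assumes "l2 f" "l2 k"
  shows "integrable (lborel \<Otimes>\<^sub>M lborel) (\<lambda>(\<theta>, x). indicat_real {0..1} \<theta> *\<^sub>R (f (x + \<theta> *\<^sub>R a) * k (x + \<theta> *\<^sub>R b)))"
proof (rule integrableI_bounded)
  note [measurable] = assms[THEN l2_measurable]
  show "(\<lambda>(\<theta>, x). indicat_real {0..1} \<theta> *\<^sub>R (f (x + \<theta> *\<^sub>R a) * k (x + \<theta> *\<^sub>R b))) \<in> borel_measurable (lborel \<Otimes>\<^sub>M lborel)"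
    by measurable
  define C where "C = (\<integral>\<^sup>+x. ennreal ((cmod (f x))\<^sup>2) \<partial>lborel) + (\<integral>\<^sup>+x. ennreal ((cmod (k x))\<^sup>2) \<partial>lborel)"
  have C: "C < \<infinity>" using assms by (auto simp: C_def l2_def)
  have le: "(\<integral>\<^sup>+x. ennreal (cmod (f (x + p) * k (x + q))) \<partial>lborel) \<le> C" for p q
  proof -
    have "(\<integral>\<^sup>+x. ennreal (cmod (f (x + p) * k (x + q))) \<partial>lborel)
       \<le> (\<integral>\<^sup>+x. ennreal ((cmod (f (x + p)))\<^sup>2) + ennreal ((cmod (k (x + q)))\<^sup>2) \<partial>lborel)"
      by (intro nn_integral_mono norm_mult_le_squares)
    also have "\<dots> = C" unfolding C_def
      using nn_integral_translate[of "\<lambda>x. ennreal ((cmod (f x))\<^sup>2)" p] nn_integral_translate[of "\<lambda>x. ennreal ((cmod (k x))\<^sup>2)" q]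
      by (subst nn_integral_add) auto
    finally show ?thesis .
  qed
  have "(\<integral>\<^sup>+z. ennreal (norm (case z of (\<theta>, x) \<Rightarrow> indicat_real {0..1} \<theta> *\<^sub>R (f (x + \<theta> *\<^sub>R a) * k (x + \<theta> *\<^sub>R b)))) \<partial>(lborel \<Otimes>\<^sub>M lborel))
     = (\<integral>\<^sup>+\<theta>. (\<integral>\<^sup>+x. ennreal (norm (indicat_real {0..1} \<theta> *\<^sub>R (f (x + \<theta> *\<^sub>R a) * k (x + \<theta> *\<^sub>R b)))) \<partial>lborel) \<partial>lborel)"
    by (subst lborel.nn_integral_fst[symmetric]) auto
  also have "\<dots> \<le> (\<integral>\<^sup>+\<theta>. C * indicator {0..1::real} \<theta> \<partial>lborel)"
  proof (rule nn_integral_mono)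
    fix \<theta> :: real
    show "(\<integral>\<^sup>+x. ennreal (norm (indicat_real {0..1} \<theta> *\<^sub>R (f (x + \<theta> *\<^sub>R a) * k (x + \<theta> *\<^sub>R b)))) \<partial>lborel) \<le> C * indicator {0..1::real} \<theta>"
      using le[of "\<theta> *\<^sub>R a" "\<theta> *\<^sub>R b"] by (cases "\<theta> \<in> {0..1}") auto
  qed
  also have "\<dots> = C" by (subst nn_integral_cmult_indicator) auto
  finally show "(\<integral>\<^sup>+z. ennreal (norm (case z of (\<theta>, x) \<Rightarrow> indicat_real {0..1} \<theta> *\<^sub>R (f (x + \<theta> *\<^sub>R a) * k (x + \<theta> *\<^sub>R b)))) \<partial>(lborel \<Otimes>\<^sub>M lborel)) < \<infinity>"
    using C by (rule le_less_trans)
qed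

text \<open>Tested against \<psi>, the shift of u is moved onto \<psi>, whose increment is an
  integral of its partial derivative. After exchanging integrals, the weak derivative acts on
  translates of \<psi>, and translating back puts the shift on g. The exceptional null set may
  depend on h.\<close>

lemma weak_pd_increment:
  assumes u: "l2 u" and g: "l2 g" and w: "weak_pd j u g"
  shows "AE x in lborel. u (x + h *\<^sub>R axis j 1) - u x = of_real h * (LINT \<theta>:{0..1}|lborel. g (x + \<theta> *\<^sub>R (h *\<^sub>R axis j 1)))"
proof -
  note [measurable] = u[THEN l2_measurable] g[THEN l2_measurable]
  define e :: "real^2" where "e = h *\<^sub>R axis j 1"
  define I where "I = (\<lambda>x. LINT \<theta>:{0..1}|lborel. g (x + \<theta> *\<^sub>R e))"
  have [measurable]: "I \<in> borel_measurable borel"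
    unfolding I_def set_lebesgue_integral_def by measurable
  have Ik: "(LINT \<theta>|lborel. indicat_real {0..1} \<theta> *\<^sub>R (g (x + \<theta> *\<^sub>R e) * k x)) = I x * k x" for k x
    unfolding I_def set_lebesgue_integral_def by (simp flip: mult_scaleR_left)
  have Ik_int: "integrable lborel (\<lambda>x. I x * k x)" if "l2 k" for k
    using lborel_pair.integrable_snd[OF shift_product_integrable[OF g that, of e 0]] by (simp add: Ik)
  have "AE x in lborel. u (x + e) - u x - of_real h * I x = 0"
  proof (rule AE_zero_if_test_integrals_zero)
    show "(\<lambda>x. u (x + e) - u x - complex_of_real h * I x) \<in> borel_measurable borel" by measurable
    show "set_integrable lborel (box a b) (\<lambda>x. u (x + e) - u x - complex_of_real h * I x)" for a b
    proof -
      have i: "l2 (\<lambda>x. of_real (indicator (box a b) x))" by (rule l2_indicator) (auto simp: bounded_box)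
      have "integrable lborel (\<lambda>x. u (x + e) * of_real (indicator (box a b) x) - u x * of_real (indicator (box a b) x)
          - of_real h * (I x * of_real (indicator (box a b) x)))"
        using l2_integrable_mult[OF l2_translate[OF u] i] l2_integrable_mult[OF u i] Ik_int[OF i]
        by (intro Bochner_Integration.integrable_diff integrable_mult_right) auto
      then show ?thesis unfolding set_integrable_def
        by (rule Bochner_Integration.integrable_cong[THEN iffD1, rotated 2])
           (auto simp: scaleR_conv_of_real algebra_simps)
    qed
    fix \<psi> assume t: "test_fun \<psi>"
    have \<psi>: "l2 (\<lambda>x. of_real (\<psi> x))" and d\<psi>: "l2 (\<lambda>x. of_real (partial j \<psi> x))" by (rule test_fun_l2[OF t])+
    note [measurable] = \<psi>[THEN l2_measurable] d\<psi>[THEN l2_measurable]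
    have ftc: "complex_of_real (\<psi> (x - e)) - of_real (\<psi> x)
       = (LINT \<theta>|lborel. indicat_real {0..1} \<theta> *\<^sub>R (- of_real h * of_real (partial j \<psi> (x + \<theta> *\<^sub>R (- e)))))" for x
    proof -
      let ?F = "\<lambda>\<theta>. complex_of_real (\<psi> (x + (- h * \<theta>) *\<^sub>R axis j 1))"
      have "((\<lambda>\<theta>. \<psi> (x + (- h * \<theta>) *\<^sub>R axis j 1)) has_real_derivative (partial j \<psi> (x + (- h * \<theta>) *\<^sub>R axis j 1) * - h)) (at \<theta> within S)" for \<theta> S
        by (rule DERIV_chain'[where f = "\<lambda>\<theta>. - h * \<theta>" and g = "\<lambda>s. \<psi> (x + s *\<^sub>R axis j 1)", OF _ has_real_derivative_partial[OF t]])
           (auto intro!: derivative_eq_intros)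
      then have "(?F has_vector_derivative of_real (partial j \<psi> (x + (- h * \<theta>) *\<^sub>R axis j 1) * - h)) (at \<theta> within S)" for \<theta> S
        by (rule has_vector_derivative_of_real)
      then have D: "(?F has_vector_derivative (- of_real h * of_real (partial j \<psi> (x + (- h * \<theta>) *\<^sub>R axis j 1)))) (at \<theta> within S)" for \<theta> S
        by (simp add: mult.commute)
      have c: "continuous_on UNIV (partial j \<psi>)" using t by (simp add: test_fun_def)
      have "continuous_on {0..1} (\<lambda>\<theta>. - of_real h * complex_of_real (partial j \<psi> (x + (- h * \<theta>) *\<^sub>R axis j 1)))"
        by (intro continuous_intros continuous_on_compose2[OF c]) auto
      from integral_FTC_atLeastAtMost[of 0 1 ?F, OF _ D this]
      show ?thesis by (simp add: e_def mult.commute)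
    qed
    have "(LINT x|lborel. u (x + e) * of_real (\<psi> x)) = (LINT x|lborel. u x * of_real (\<psi> (x - e)))"
      using integral_translate[of "\<lambda>x. u x * of_real (\<psi> (x - e))" e] by simp
    moreover have "integrable lborel (\<lambda>x. u x * of_real (\<psi> (x - e)))"
      using l2_integrable_mult[OF u l2_translate[OF \<psi>, of "-e"]] by simp
    ultimately have "(LINT x|lborel. u (x + e) * of_real (\<psi> x)) - (LINT x|lborel. u x * of_real (\<psi> x))
      = (LINT x|lborel. u x * (of_real (\<psi> (x - e)) - of_real (\<psi> x)))"
      using l2_integrable_mult[OF u \<psi>] by (simp add: right_diff_distrib)
    \<comment> \<open>The zero shift keeps the integrand in the shape of
      \<open>shift_product_integrable\<close>, which justifies the exchange that follows.\<close>
    also have "\<dots> = (LINT x|lborel. LINT \<theta>|lborel. - of_real h * (indicat_real {0..1} \<theta> *\<^sub>R (u (x + \<theta> *\<^sub>R 0) * of_real (partial j \<psi> (x + \<theta> *\<^sub>R (- e))))))"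
      unfolding ftc by (simp add: mult_ac flip: integral_mult_right_zero mult_scaleR_right mult_scaleR_left)
    also have "\<dots> = (LINT \<theta>|lborel. LINT x|lborel. - of_real h * (indicat_real {0..1} \<theta> *\<^sub>R (u (x + \<theta> *\<^sub>R 0) * of_real (partial j \<psi> (x + \<theta> *\<^sub>R (- e))))))"
      by (rule lborel_pair.Fubini_integral)
         (use integrable_mult_right[OF shift_product_integrable[OF u d\<psi>, of 0 "-e"], of "- of_real h"] in \<open>simp add: case_prod_unfold\<close>)
    also have "\<dots> = (LINT \<theta>|lborel. LINT x|lborel. of_real h * (indicat_real {0..1} \<theta> *\<^sub>R (g (x + \<theta> *\<^sub>R e) * of_real (\<psi> x))))"
    proof (rule Bochner_Integration.integral_cong[OF refl])
      fix \<theta> :: real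
      have "(LINT x|lborel. u x * of_real (partial j \<psi> (x + \<theta> *\<^sub>R (- e)))) = - (LINT x|lborel. g x * of_real (\<psi> (x + \<theta> *\<^sub>R (- e))))"
        using w[unfolded weak_pd_def, rule_format, OF test_fun_translate[OF t, of "\<theta> *\<^sub>R (- e)"]] by (simp only: partial_translate)
      also have "\<dots> = - (LINT x|lborel. g (x + \<theta> *\<^sub>R e) * of_real (\<psi> x))"
        using integral_translate[of "\<lambda>x. g x * of_real (\<psi> (x + \<theta> *\<^sub>R (- e)))" "\<theta> *\<^sub>R e"] by simp
      finally show "(LINT x|lborel. - of_real h * (indicat_real {0..1} \<theta> *\<^sub>R (u (x + \<theta> *\<^sub>R 0) * of_real (partial j \<psi> (x + \<theta> *\<^sub>R (- e))))))
         = (LINT x|lborel. of_real h * (indicat_real {0..1} \<theta> *\<^sub>R (g (x + \<theta> *\<^sub>R e) * of_real (\<psi> x))))"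
        by simp
    qed
    also have "\<dots> = (LINT x|lborel. LINT \<theta>|lborel. of_real h * (indicat_real {0..1} \<theta> *\<^sub>R (g (x + \<theta> *\<^sub>R e) * of_real (\<psi> (x + \<theta> *\<^sub>R 0)))))"
      by (subst lborel_pair.Fubini_integral[symmetric])
         (use integrable_mult_right[OF shift_product_integrable[OF g \<psi>, of e 0], of "of_real h"] in \<open>simp_all add: case_prod_unfold\<close>)
    also have "\<dots> = (LINT x|lborel. of_real h * (I x * of_real (\<psi> x)))"
      by (simp only: scaleR_zero_right add_0_right integral_mult_right_zero Ik[where k = "\<lambda>x. of_real (\<psi> x)"])
    finally have "(LINT x|lborel. u (x + e) * of_real (\<psi> x)) - (LINT x|lborel. u x * of_real (\<psi> x))
       - (LINT x|lborel. of_real h * (I x * of_real (\<psi> x))) = 0" by simp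
    moreover have "(LINT x|lborel. (u (x + e) - u x - of_real h * I x) * of_real (\<psi> x)) =
       (LINT x|lborel. u (x + e) * of_real (\<psi> x) - u x * of_real (\<psi> x) - of_real h * (I x * of_real (\<psi> x)))"
      by (simp add: algebra_simps)
    moreover have "\<dots> = (LINT x|lborel. u (x + e) * of_real (\<psi> x)) - (LINT x|lborel. u x * of_real (\<psi> x))
       - (LINT x|lborel. of_real h * (I x * of_real (\<psi> x)))"
      using l2_integrable_mult[OF l2_translate[OF u] \<psi>] l2_integrable_mult[OF u \<psi>] Ik_int[OF \<psi>]
      by (subst Bochner_Integration.integral_diff; simp)+
    ultimately show "(LINT x|lborel. (u (x + e) - u x - of_real h * I x) * of_real (\<psi> x)) = 0" by simp
  qed
  then show ?thesis unfolding e_def I_def by eventually_elim simp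
qed

lemma slice_add_axis: "slice j s y + h *\<^sub>R axis j 1 = slice j (s + h) y"
  by (auto simp: vec_eq_iff slice_nth axis_def)

lemma l2_slice:
  assumes "l2 g" shows "AE y in lborel. l2 (\<lambda>s. g (slice j s y))"
proof -
  note [measurable] = assms[THEN l2_measurable]
  have "(\<integral>\<^sup>+y. (\<integral>\<^sup>+s. ennreal ((cmod (g (slice j s y)))\<^sup>2) \<partial>lborel) \<partial>lborel) \<noteq> \<infinity>"
    using assms nn_integral_slice[of "\<lambda>x. ennreal ((cmod (g x))\<^sup>2)" j] by (simp add: l2_def)
  then have "AE y in lborel. (\<integral>\<^sup>+s. ennreal ((cmod (g (slice j s y)))\<^sup>2) \<partial>lborel) \<noteq> \<infinity>"
    by (intro nn_integral_PInf_AE) auto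
  then show ?thesis by eventually_elim (auto simp: l2_def less_top)
qed

lemma l2_set_integrable_Icc:
  fixes f :: "real \<Rightarrow> complex"
  assumes "l2 f" shows "set_integrable lborel {a..b} f"
proof -
  have "l2 (\<lambda>x::real. of_real (indicator {a..b} x))"
    by (rule l2_bounded_support[of _ 1 "{a..b}"]) (auto split: split_indicator_asm split_indicator simp: bounded_closed_interval)
  from l2_integrable_mult[OF assms this] show ?thesis
    by (simp add: set_integrable_def scaleR_conv_of_real mult.commute)
qed

lemma primitive_continuous:
  fixes v \<gamma> :: "real \<Rightarrow> complex"
  assumes int: "\<And>a b. set_integrable lborel {a..b} \<gamma>"
    and eq: "\<And>a b. a \<le> b \<Longrightarrow> v b - v a = (LINT s:{a..b}|lborel. \<gamma> s)"
  shows "continuous_on UNIV v"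
proof (rule continuous_at_imp_continuous_on, rule ballI)
  fix x :: real
  have "continuous_on {x-1..x+1} (\<lambda>t. integral {x-1..t} \<gamma>)"
    by (rule indefinite_integral_continuous_1[OF set_borel_integral_eq_integral(1)[OF int]])
  then have "continuous_on {x-1..x+1} (\<lambda>t. v (x-1) + integral {x-1..t} \<gamma>)" by (intro continuous_intros)
  then have "continuous_on {x-1..x+1} v"
  proof (rule continuous_on_cong[THEN iffD1, rotated 2, OF _ refl])
    fix t assume "t \<in> {x-1..x+1}"
    then have "v t - v (x-1) = integral {x-1..t} \<gamma>"
      using eq[of "x-1" t] set_borel_integral_eq_integral(2)[OF int, of "x-1" t] by simp
    then show "v (x-1) + integral {x-1..t} \<gamma> = v t" by (simp add: algebra_simps)
  qed
  then show "isCont v x" by (rule continuous_on_interior) simp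
qed

lemma AE_lborel_translate:
  fixes P :: "real \<Rightarrow> bool"
  assumes "AE h in lborel. P (c + h)" shows "AE x in lborel. P x"
proof -
  have "AE x in distr lborel borel ((+) (- c)). P (c + x)" using assms unfolding lborel_distr_plus .
  then have "AE x in lborel. P (c + (- c + x))" by (rule AE_distrD[rotated]) simp
  then show ?thesis by simp
qed

text \<open>Substitution t = s + \<theta> h. For h < 0 the map reverses orientation, which accounts
  for the minus sign and the exchanged endpoints.\<close>

lemma set_integral_affine:
  fixes \<gamma> :: "real \<Rightarrow> complex"
  shows "of_real h * (LINT \<theta>:{0..1}|lborel. \<gamma> (s + \<theta> * h))
    = (if h \<ge> 0 then LINT t:{s..s+h}|lborel. \<gamma> t else - (LINT t:{s+h..s}|lborel. \<gamma> t))"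
proof -
  consider "h = 0" | "h > 0" | "h < 0" by linarith
  then show ?thesis
  proof cases
    case 1
    have "(LINT t:{s..s}|lborel. \<gamma> t) = 0"
    proof -
      have "AE t in lborel. indicator {s..s} t *\<^sub>R \<gamma> t = 0"
        using AE_lborel_singleton[of s] by eventually_elim auto
      then show ?thesis unfolding set_lebesgue_integral_def by (rule integral_eq_zero_AE)
    qed
    then show ?thesis using 1 by simp
  next
    case 2
    have "indicat_real {s..s+h} (s + h * \<theta>) = indicator {0..1} \<theta>" for \<theta>
      using 2 mult_le_cancel_left_pos[of h \<theta> 1] by (auto simp: indicator_def zero_le_mult_iff)
    then show ?thesis unfolding set_lebesgue_integral_def
      using 2 lborel_integral_real_affine[of h "\<lambda>t. indicator {s..s+h} t *\<^sub>R \<gamma> t" s] by (simp add: mult.commute scaleR_conv_of_real)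
  next
    case 3
    have "indicat_real {s+h..s} (s + h * \<theta>) = indicator {0..1} \<theta>" for \<theta>
      using 3 mult_le_cancel_left_neg[of h 1 \<theta>] by (auto simp: indicator_def mult_le_0_iff)
    then show ?thesis unfolding set_lebesgue_integral_def
      using 3 lborel_integral_real_affine[of h "\<lambda>t. indicator {s+h..s} t *\<^sub>R \<gamma> t" s] by (simp add: mult.commute scaleR_conv_of_real)
  qed
qed

text \<open>Almost every line contains a base point from which the increment formula holds for
  almost every h. The representative v is the value of u there plus the oriented integral of
  g.\<close>

lemma weak_pd_absolutely_continuous_slices:
  assumes u: "l2 u" and g: "l2 g" and w: "weak_pd j u g"
  shows "AE y in lborel. l2 (\<lambda>s. g (slice j s y)) \<and> (\<exists>v. (AE s in lborel. v s = u (slice j s y)) \<and>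
     (\<forall>a b. a \<le> b \<longrightarrow> v b - v a = (LINT s:{a..b}|lborel. g (slice j s y))))"
proof -
  note [measurable] = u[THEN l2_measurable] g[THEN l2_measurable]
  let ?P = "\<lambda>h x. u (x + h *\<^sub>R axis j 1) - u x = of_real h * (LINT \<theta>|lborel. indicat_real {0..1} \<theta> *\<^sub>R g (x + \<theta> *\<^sub>R (h *\<^sub>R axis j 1)))"
  have "AE h in lborel. AE x in lborel. ?P h x"
    using weak_pd_increment[OF assms, unfolded set_lebesgue_integral_def] by simp
  \<comment> \<open>Exchanging the quantifiers removes the dependence of the null set on h; it
    requires joint measurability of the formula in (h, x).\<close>
  then have "AE x in lborel. AE h in lborel. ?P h x"
  proof (subst (asm) lborel_pair.AE_commute)
    have [measurable]: "(\<lambda>z::real \<times> (real^2). LINT \<theta>|lborel. indicat_real {0..1} \<theta> *\<^sub>R g (snd z + \<theta> *\<^sub>R (fst z *\<^sub>R axis j 1)))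
       \<in> borel_measurable (lborel \<Otimes>\<^sub>M lborel)"
      by (rule lborel.borel_measurable_lebesgue_integral) measurable
    show "{z \<in> space (lborel \<Otimes>\<^sub>M lborel). ?P (fst z) (snd z)} \<in> sets (lborel \<Otimes>\<^sub>M lborel)"
      by measurable
  qed
  then have "AE y in lborel. AE s in lborel. AE h in lborel. ?P h (slice j s y)"
    by (rule AE_slice)
  then show ?thesis using l2_slice[OF g, of j]
  proof eventually_elim
    case (elim y)
    define \<gamma> where "\<gamma> = (\<lambda>s. g (slice j s y))"
    have \<gamma>: "l2 \<gamma>" using elim by (simp add: \<gamma>_def)
    note int = l2_set_integrable_Icc[OF \<gamma>]
    \<comment> \<open>A property that holds almost everywhere on the line holds somewhere, since the
      line is not a null set.\<close>
    have "\<exists>s. AE h in lborel. ?P h (slice j s y)"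
      by (rule eventually_happens'[OF _ elim(1)]) (simp add: ae_filter_eq_bot_iff)
    then obtain s where s: "AE h in lborel. ?P h (slice j s y)" by blast
    define V where "V = (\<lambda>b. if b \<ge> s then LINT t:{s..b}|lborel. \<gamma> t else - (LINT t:{b..s}|lborel. \<gamma> t))"
    have "AE b in lborel. u (slice j s y) + V b = u (slice j b y)"
    proof (rule AE_lborel_translate[of "\<lambda>b. u (slice j s y) + V b = u (slice j b y)" s])
      show "AE h in lborel. u (slice j s y) + V (s + h) = u (slice j (s + h) y)"
        using s
      proof (rule eventually_mono)
        fix h assume "?P h (slice j s y)"
        then have "u (slice j (s + h) y) - u (slice j s y) = of_real h * (LINT \<theta>:{0..1}|lborel. \<gamma> (s + \<theta> * h))"
          by (simp add: slice_add_axis \<gamma>_def set_lebesgue_integral_def)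
        then show "u (slice j s y) + V (s + h) = u (slice j (s + h) y)"
          unfolding set_integral_affine by (auto simp: V_def algebra_simps split: if_splits)
      qed
    qed
    moreover have "u (slice j s y) + V b - (u (slice j s y) + V a) = (LINT s:{a..b}|lborel. \<gamma> s)" if "a \<le> b" for a b
    proof -
      consider "s \<le> a" | "a < s" "s \<le> b" | "b < s" by linarith
      then show ?thesis
      proof cases
        case 1
        then show ?thesis using that set_integral_combine[OF int 1 that] by (simp add: V_def)
      next
        case 2
        then show ?thesis using set_integral_combine[OF int, of a s b] by (simp add: V_def)
      next
        case 3
        then show ?thesis using that set_integral_combine[OF int that, of s] by (simp add: V_def)
      qed
    qed
    ultimately show ?case
      using \<gamma> unfolding \<gamma>_def by (intro conjI exI[of _ "\<lambda>b. u (slice j s y) + V b"]) simp_all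
  qed
qed

subsection \<open>The Gagliardo--Nirenberg inequality\<close>

text \<open>Only the component Re (cnj u * g) of a weak derivative g enters the estimates, so
  \<open>D\<close> may differ from g in the direction orthogonal to u. Both \<open>wd\<close> and
  \<open>Dcov\<close> fit.\<close>

definition covariant_gradient :: "cfun \<Rightarrow> (2 \<Rightarrow> cfun) \<Rightarrow> bool" where
  "covariant_gradient u D \<longleftrightarrow> l2 u \<and> (\<forall>j. D j \<in> borel_measurable borel \<and>
     (\<exists>g. l2 g \<and> weak_pd j u g \<and> (\<forall>x. Re (cnj (u x) * g x) = Re (cnj (u x) * D j x))))"

text \<open>The converse of \<open>AE_slice\<close>. Null slices do not control a non-measurable
  set, hence the measurability assumption.\<close>

lemma AE_from_slices:
  assumes [measurable]: "{x. P x} \<in> sets borel"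
    and "AE y in lborel. AE s in lborel. P (slice j s y)"
  shows "AE x in lborel. P x"
proof -
  have "(\<integral>\<^sup>+x. indicator (- {x. P x}) x \<partial>lborel) = (\<integral>\<^sup>+y. (\<integral>\<^sup>+s. indicator (- {x. P x}) (slice j s y) \<partial>lborel) \<partial>lborel)"
    by (rule nn_integral_slice) simp
  also have "\<dots> = (\<integral>\<^sup>+(y::real). 0 \<partial>lborel)"
  proof (rule nn_integral_cong_AE, use assms(2) in eventually_elim)
    case (elim y)
    have "(\<integral>\<^sup>+s. indicator (- {x. P x}) (slice j s y) \<partial>lborel) = (\<integral>\<^sup>+(s::real). 0 \<partial>lborel)"
      by (rule nn_integral_cong_AE, use elim in eventually_elim) auto
    then show ?case by simp
  qed
  finally have "AE x in lborel. indicator (- {x. P x}) x = (0::ennreal)"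
    using nn_integral_0_iff_AE[of "indicator (- {x. P x})" lborel] by simp
  then show ?thesis by eventually_elim (auto split: split_indicator_asm)
qed

text \<open>The right-hand side does not involve s: on almost every line the power of |u| is
  dominated by a function of the transverse coordinate alone. The bound is proved for the continuous
  representative and carried over to u almost everywhere.\<close>

lemma slice_power_le:
  assumes "covariant_gradient u D"
  shows "AE y in lborel. AE s in lborel. ennreal (cmod (u (slice j s y)) ^ (k+2))
    \<le> ennreal (2 * real (k+1)) * (\<integral>\<^sup>+t. ennreal (cmod (u (slice j t y)) ^ (k+1) * cmod (D j (slice j t y))) \<partial>lborel)"
proof -
  obtain g where u: "l2 u" and g: "l2 g" "weak_pd j u g" and re: "\<And>x. Re (cnj (u x) * g x) = Re (cnj (u x) * D j x)"
    using assms unfolding covariant_gradient_def by blast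
  show ?thesis using weak_pd_absolutely_continuous_slices[OF u g] l2_slice[OF u, of j]
  proof eventually_elim
    case (elim y)
    define \<gamma> where "\<gamma> = (\<lambda>s. g (slice j s y))"
    have \<gamma>: "l2 \<gamma>" using elim by (simp add: \<gamma>_def)
    obtain v where v: "AE s in lborel. v s = u (slice j s y)" "\<And>a b. a \<le> b \<Longrightarrow> v b - v a = (LINT s:{a..b}|lborel. \<gamma> s)"
      using elim unfolding \<gamma>_def by blast
    note int = l2_set_integrable_Icc[OF \<gamma>]
    have cont: "continuous_on UNIV v" by (rule primitive_continuous[OF int v(2)])
    have "(\<integral>\<^sup>+s. ennreal ((cmod (v s))^2) \<partial>lborel) = (\<integral>\<^sup>+s. ennreal ((cmod (u (slice j s y)))^2) \<partial>lborel)"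
      by (rule nn_integral_cong_AE, use v(1) in eventually_elim) simp
    then have L2: "(\<integral>\<^sup>+s. ennreal ((cmod (v s))^2) \<partial>lborel) < \<infinity>" using elim by (simp add: l2_def)
    have "(\<integral>\<^sup>+t. ennreal (cmod (v t)^k * \<bar>Re (cnj (v t) * \<gamma> t)\<bar>) \<partial>lborel)
       \<le> (\<integral>\<^sup>+t. ennreal (cmod (u (slice j t y)) ^ (k+1) * cmod (D j (slice j t y))) \<partial>lborel)"
    proof (rule nn_integral_mono_AE, use v(1) in eventually_elim)
      case (elim t)
      have "\<bar>Re (cnj (v t) * \<gamma> t)\<bar> \<le> cmod (u (slice j t y)) * cmod (D j (slice j t y))"
        unfolding elim \<gamma>_def re using abs_Re_le_cmod[of "cnj (u (slice j t y)) * D j (slice j t y)"]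
        by (simp only: norm_mult complex_mod_cnj)
      then have "cmod (v t)^k * \<bar>Re (cnj (v t) * \<gamma> t)\<bar> \<le> cmod (u (slice j t y))^k * (cmod (u (slice j t y)) * cmod (D j (slice j t y)))"
        unfolding elim by (intro mult_left_mono) auto
      then show ?case by (intro ennreal_leI) (simp add: mult_ac)
    qed
    then have *: "ennreal (cmod (v s) ^ (k+2))
       \<le> ennreal (2 * real (k+1)) * (\<integral>\<^sup>+t. ennreal (cmod (u (slice j t y)) ^ (k+1) * cmod (D j (slice j t y))) \<partial>lborel)" for s
      using primitive_power_le_nn_integral[OF l2_measurable[OF \<gamma>] int v(2) cont L2, of s k]
      by (meson mult_left_mono order_trans zero_le)
    show ?case
      using v(1)
    proof (rule eventually_mono)
      fix s assume "v s = u (slice j s y)"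
      from *[of s, unfolded this]
      show "ennreal (cmod (u (slice j s y)) ^ (k+2))
        \<le> ennreal (2 * real (k+1)) * (\<integral>\<^sup>+t. ennreal (cmod (u (slice j t y)) ^ (k+1) * cmod (D j (slice j t y))) \<partial>lborel)" .
    qed
  qed
qed

text \<open>Gagliardo's argument in the plane: one factor of |u|^(2k+4) is bounded by a function of
  x_2, the other by a function of x_1, so the integral of the product factorises. Cauchy-Schwarz
  then separates |u|^(k+1) from \<open>D j\<close>.\<close>

lemma gagliardo_nirenberg_step:
  assumes D: "covariant_gradient u D"
    and X: "\<And>j. (\<integral>\<^sup>+x. ennreal ((cmod (D j x))\<^sup>2) \<partial>lborel) \<le> X"
  shows "(\<integral>\<^sup>+x. ennreal (cmod (u x) ^ (2 * (k+2))) \<partial>lborel)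
     \<le> ennreal (4 * (real (k+1))\<^sup>2) * ((\<integral>\<^sup>+x. ennreal (cmod (u x) ^ (2 * (k+1))) \<partial>lborel) * X)"
proof -
  have [measurable]: "u \<in> borel_measurable borel" "\<And>j. D j \<in> borel_measurable borel"
    using D by (auto simp: covariant_gradient_def l2_def)
  define c where "c = ennreal (2 * real (k+1))"
  define F where "F = (\<lambda>j y. c * (\<integral>\<^sup>+t. ennreal (cmod (u (slice j t y)) ^ (k+1) * cmod (D j (slice j t y))) \<partial>lborel))"
  have [measurable]: "F j \<in> borel_measurable borel" for j unfolding F_def by measurable
  define A where "A = (\<lambda>j. \<integral>\<^sup>+x. ennreal (cmod (u x) ^ (k+1)) * ennreal (cmod (D j x)) \<partial>lborel)"
  define M where "M = (\<integral>\<^sup>+x. ennreal (cmod (u x) ^ (2 * (k+1))) \<partial>lborel)"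
  have FA: "(\<integral>\<^sup>+y. F j y \<partial>lborel) = c * A j" for j
    unfolding F_def A_def
    by (subst nn_integral_slice[of _ j]) (simp_all add: nn_integral_cmult ennreal_mult)
  have ptw: "AE x in lborel. ennreal (cmod (u x) ^ (k+2)) \<le> F j (x $ i)" if "i \<noteq> j" for i j
  proof (rule AE_from_slices[where j = j])
    show "{x. ennreal (cmod (u x) ^ (k+2)) \<le> F j (x $ i)} \<in> sets borel" by measurable
    show "AE y in lborel. AE s in lborel. ennreal (cmod (u (slice j s y)) ^ (k+2)) \<le> F j (slice j s y $ i)"
      using slice_power_le[OF D, of j k] that unfolding F_def c_def by (simp add: slice_nth)
  qed
  have "(\<integral>\<^sup>+x. ennreal (cmod (u x) ^ (2 * (k+2))) \<partial>lborel) \<le> (\<integral>\<^sup>+(x::real^2). F 1 (x $ 2) * F 2 (x $ 1) \<partial>lborel)"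
  proof (rule nn_integral_mono_AE)
    show "AE x in lborel. ennreal (cmod (u x) ^ (2 * (k+2))) \<le> F 1 (x $ 2) * F 2 (x $ 1)"
      using ptw[of 2 1, simplified] ptw[of 1 2, simplified]
    proof eventually_elim
      case (elim x)
      have "ennreal (cmod (u x) ^ (2 * (k+2))) = ennreal (cmod (u x) ^ (k+2)) * ennreal (cmod (u x) ^ (k+2))"
        by (subst ennreal_mult[symmetric]) (simp_all add: power_add mult_2)
      also have "\<dots> \<le> F 1 (x $ 2) * F 2 (x $ 1)" using elim by (intro mult_mono) auto
      finally show ?case .
    qed
  qed
  also have "\<dots> = (\<integral>\<^sup>+y. (\<integral>\<^sup>+s. F 1 y * F 2 s \<partial>lborel) \<partial>lborel)"
    by (subst nn_integral_slice[of _ 1]) (simp_all add: slice_nth)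
  also have "\<dots> = (c * A 1) * (c * A 2)"
    by (simp add: nn_integral_cmult nn_integral_multc FA)
  also have "\<dots> = c\<^sup>2 * (A 1 * A 2)" by (simp add: power2_eq_square mult_ac)
  also have "\<dots> \<le> c\<^sup>2 * (M * X)"
  proof (rule mult_left_mono)
    have sq: "A j ^ 2 \<le> M * X" for j
    proof -
      have "A j ^ 2 \<le> (\<integral>\<^sup>+x. ennreal (cmod (u x) ^ (k+1)) ^ 2 \<partial>lborel) * (\<integral>\<^sup>+x. ennreal (cmod (D j x)) ^ 2 \<partial>lborel)"
        unfolding A_def by (rule Cauchy_Schwarz_nn_integral) auto
      also have "(\<integral>\<^sup>+x. ennreal (cmod (u x) ^ (k+1)) ^ 2 \<partial>lborel) = M"
        unfolding M_def by (intro nn_integral_cong) (simp only: ennreal_power zero_le_power norm_ge_zero power_mult[symmetric] mult.commute)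
      also have "(\<integral>\<^sup>+x. ennreal (cmod (D j x)) ^ 2 \<partial>lborel) = (\<integral>\<^sup>+x. ennreal ((cmod (D j x))\<^sup>2) \<partial>lborel)"
        by (simp add: ennreal_power)
      also have "M * \<dots> \<le> M * X" by (intro mult_left_mono X) simp
      finally show ?thesis .
    qed
    \<comment> \<open>The same \<open>X\<close> bounds both directions, so the square of the larger
      factor suffices and no square roots in \<open>ennreal\<close> occur.\<close>
    consider "A 1 \<le> A 2" | "A 2 \<le> A 1" by (meson linear)
    then show "A 1 * A 2 \<le> M * X"
    proof cases
      case 1
      then have "A 1 * A 2 \<le> A 2 * A 2" by (intro mult_right_mono) auto
      then show ?thesis using sq[of 2] by (simp add: power2_eq_square)
    next
      case 2
      then have "A 1 * A 2 \<le> A 1 * A 1" by (intro mult_left_mono) auto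
      then show ?thesis using sq[of 1] by (simp add: power2_eq_square)
    qed
  qed simp
  also have "c\<^sup>2 = ennreal (4 * (real (k+1))\<^sup>2)" unfolding c_def by (subst ennreal_power) (auto simp: power2_eq_square algebra_simps)
  finally show ?thesis unfolding M_def .
qed

text \<open>Each step lowers the exponent by 2 at the cost of one factor \<open>X\<close>; after m
  steps the mass is left.\<close>

lemma gagliardo_nirenberg:
  "\<exists>C::real. C \<ge> 0 \<and> (\<forall>u D X. covariant_gradient u D \<longrightarrow> (\<forall>j. (\<integral>\<^sup>+x. ennreal ((cmod (D j x))\<^sup>2) \<partial>lborel) \<le> X) \<longrightarrow>
    (\<integral>\<^sup>+x. ennreal (cmod (u x) ^ (2 * (m+1))) \<partial>lborel) \<le> ennreal C * ((\<integral>\<^sup>+x. ennreal ((cmod (u x))\<^sup>2) \<partial>lborel) * X ^ m))"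
proof (induction m)
  case 0
  show ?case by (rule exI[of _ 1]) simp
next
  case (Suc m)
  then obtain C where C: "C \<ge> 0" "\<And>u D X. covariant_gradient u D \<Longrightarrow> (\<And>j. (\<integral>\<^sup>+x. ennreal ((cmod (D j x))\<^sup>2) \<partial>lborel) \<le> X) \<Longrightarrow>
    (\<integral>\<^sup>+x. ennreal (cmod (u x) ^ (2 * (m+1))) \<partial>lborel) \<le> ennreal C * ((\<integral>\<^sup>+x. ennreal ((cmod (u x))\<^sup>2) \<partial>lborel) * X ^ m)" by blast
  show ?case
  proof (intro exI[of _ "4 * (real (m+1))\<^sup>2 * C"] conjI allI impI)
    fix u D X assume D: "covariant_gradient u D" and X: "\<forall>j. (\<integral>\<^sup>+x. ennreal ((cmod (D j x))\<^sup>2) \<partial>lborel) \<le> X"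
    have "(\<integral>\<^sup>+x. ennreal (cmod (u x) ^ (2 * (Suc m+1))) \<partial>lborel)
      \<le> ennreal (4 * (real (m+1))\<^sup>2) * ((\<integral>\<^sup>+x. ennreal (cmod (u x) ^ (2 * (m+1))) \<partial>lborel) * X)"
      using gagliardo_nirenberg_step[OF D X[rule_format], of m] by simp
    also have "\<dots> \<le> ennreal (4 * (real (m+1))\<^sup>2) * ((ennreal C * ((\<integral>\<^sup>+x. ennreal ((cmod (u x))\<^sup>2) \<partial>lborel) * X ^ m)) * X)"
      by (intro mult_left_mono mult_right_mono C(2)[OF D] X[rule_format]) auto
    also have "\<dots> = ennreal (4 * (real (m+1))\<^sup>2 * C) * ((\<integral>\<^sup>+x. ennreal ((cmod (u x))\<^sup>2) \<partial>lborel) * X ^ Suc m)"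
      using C(1) by (subst ennreal_mult) (auto simp: mult_ac)
    finally show "(\<integral>\<^sup>+x. ennreal (cmod (u x) ^ (2 * (Suc m+1))) \<partial>lborel)
      \<le> ennreal (4 * (real (m+1))\<^sup>2 * C) * ((\<integral>\<^sup>+x. ennreal ((cmod (u x))\<^sup>2) \<partial>lborel) * X ^ Suc m)" .
  qed (use C in simp)
qed

subsection \<open>Square-integrability of the covariant derivatives\<close>

text \<open>The local singularity of the kernels \<open>G j\<close>, cut off at radius 1 so that it
  is integrable over the plane.\<close>

definition sing_kernel :: "real^2 \<Rightarrow> real" where
  "sing_kernel z = indicator (cball 0 1) z / norm z"

lemma sing_kernel_measurable [measurable]: "sing_kernel \<in> borel_measurable borel"
proof -
  have "norm \<in> borel_measurable (borel :: (real^2) measure)" "cball 0 1 \<in> sets (borel :: (real^2) measure)"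
    by (auto intro: borel_measurable_continuous_onI continuous_on_norm_id)
  then have "(\<lambda>z::real^2. indicat_real (cball 0 1) z / norm z) \<in> borel_measurable borel"
    by (intro borel_measurable_divide borel_measurable_indicator)
  then show ?thesis by (simp add: sing_kernel_def[abs_def])
qed

lemma sing_kernel_nonneg: "sing_kernel z \<ge> 0" by (simp add: sing_kernel_def)

lemma sing_kernel_minus: "sing_kernel (x - y) = sing_kernel (y - x)"
  by (simp add: sing_kernel_def norm_minus_commute indicator_def)

lemma nn_integral_inverse_sqrt_abs:
  "(\<integral>\<^sup>+t. ennreal (\<bar>t\<bar> powr (-1/2)) * indicator {-1..1} t \<partial>lborel) < \<infinity>"
proof -
  let ?h = "\<lambda>t::real. ennreal (t powr (-1/2)) * indicator {0..1} t"
  have h: "(\<integral>\<^sup>+t. ?h t \<partial>lborel) < \<infinity>"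
    using nn_integral_has_integral_lebesgue'[OF _ has_integral_powr_from_0[of "-1/2" 1]] by simp
  have "(\<integral>\<^sup>+t. ennreal (\<bar>t\<bar> powr (-1/2)) * indicator {-1..1} t \<partial>lborel) \<le> (\<integral>\<^sup>+t. ?h t + ?h (- t) \<partial>lborel)"
    by (intro nn_integral_mono) (auto split: split_indicator)
  also have "\<dots> = (\<integral>\<^sup>+t. ?h t \<partial>lborel) + (\<integral>\<^sup>+t. ?h (- t) \<partial>lborel)"
    by (rule nn_integral_add) auto
  also have "(\<integral>\<^sup>+t. ?h (- t) \<partial>lborel) = (\<integral>\<^sup>+t. ?h t \<partial>lborel)"
    by (subst (2) lborel_distr_uminus[symmetric]) (simp add: nn_integral_distr)
  finally show ?thesis using h by (auto intro: le_less_trans)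
qed

lemma AE_nth_neq: "AE x in lborel. (x::real^2) $ i \<noteq> c"
proof (rule AE_from_slices[where j = i])
  show "{x::real^2. x $ i \<noteq> c} \<in> sets borel" by measurable
  show "AE y in lborel. AE s in lborel. slice i s y $ i \<noteq> c"
    by (simp add: slice_nth AE_lborel_singleton)
qed

text \<open>The bound \<open>|z|\<^sup>2 \<ge> |z\<^sub>1| |z\<^sub>2|\<close> separates the variables.\<close>

lemma nn_integral_sing_kernel: "(\<integral>\<^sup>+z. ennreal (sing_kernel z) \<partial>lborel) < \<infinity>"
proof -
  define k where "k = (\<lambda>t::real. ennreal (\<bar>t\<bar> powr (-1/2)) * indicator {-1..1} t)"
  have [measurable]: "k \<in> borel_measurable borel" unfolding k_def by measurable
  have "(\<integral>\<^sup>+z. ennreal (sing_kernel z) \<partial>lborel) \<le> (\<integral>\<^sup>+(z::real^2). k (z$1) * k (z$2) \<partial>lborel)"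
  proof (rule nn_integral_mono_AE)
    show "AE z in lborel. ennreal (sing_kernel z) \<le> k (z$1) * k (z$2)"
      using AE_nth_neq[of 1 0] AE_nth_neq[of 2 0]
    proof eventually_elim
      case (elim z)
      show ?case
      proof (cases "norm z \<le> 1")
        case True
        then have b: "\<bar>z$i\<bar> \<le> 1" for i using component_le_norm_cart[of z i] by linarith
        have sq: "(norm z)\<^sup>2 = (z$1)\<^sup>2 + (z$2)\<^sup>2"
          by (simp add: norm_vec_def L2_set_def sum_2)
        have "\<bar>z$1\<bar> * \<bar>z$2\<bar> \<le> (norm z)\<^sup>2"
          using sum_squares_bound[of "\<bar>z$1\<bar>" "\<bar>z$2\<bar>"] mult_nonneg_nonneg[of "\<bar>z$1\<bar>" "\<bar>z$2\<bar>"] abs_ge_zero unfolding sq power2_abs by linarith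
        then have le: "sqrt (\<bar>z$1\<bar> * \<bar>z$2\<bar>) \<le> norm z" by (intro real_le_lsqrt) auto
        have "1 / norm z \<le> 1 / sqrt (\<bar>z$1\<bar> * \<bar>z$2\<bar>)"
        proof (intro divide_left_mono le mult_pos_pos)
          show "0 < norm z" using elim by auto
          show "0 < sqrt (\<bar>z$1\<bar> * \<bar>z$2\<bar>)" using elim by simp
        qed simp
        also have "\<dots> = \<bar>z$1\<bar> powr (-1/2) * \<bar>z$2\<bar> powr (-1/2)"
          using elim by (simp add: powr_minus_divide powr_half_sqrt real_sqrt_mult)
        finally have "ennreal (1 / norm z) \<le> ennreal (\<bar>z$1\<bar> powr (-1/2) * \<bar>z$2\<bar> powr (-1/2))" by (rule ennreal_leI)
        then show ?thesis using True b[of 1] b[of 2]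
          by (simp add: sing_kernel_def k_def ennreal_mult abs_le_iff)
      qed (simp add: sing_kernel_def)
    qed
  qed
  also have "\<dots> = (\<integral>\<^sup>+y. (\<integral>\<^sup>+s. k s * k y \<partial>lborel) \<partial>lborel)"
    by (subst nn_integral_slice[of _ 1]) (simp_all add: slice_nth)
  also have "\<dots> = (\<integral>\<^sup>+t. k t \<partial>lborel) * (\<integral>\<^sup>+t. k t \<partial>lborel)"
    by (simp add: nn_integral_cmult nn_integral_multc)
  also have "\<dots> < \<infinity>"
    using nn_integral_inverse_sqrt_abs unfolding k_def by (simp add: ennreal_mult_less_top)
  finally show ?thesis .
qed

text \<open>|G_j(z)| \<le> 1/|z|, which is at most 1 outside the unit ball. The far part of the
  potential is thereby controlled by the mass alone.\<close>

lemma abs_G_le: "\<bar>G j z\<bar> \<le> 1 + sing_kernel z"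
proof (cases "z = 0")
  case False
  have "\<bar>G j z\<bar> = (1 / (2 * pi)) * (\<bar>z $ j\<bar> / (norm z)\<^sup>2)" by (simp add: G_def abs_mult)
  also have "\<dots> \<le> 1 * (1 / norm z)"
  proof (intro mult_mono)
    show "1 / (2 * pi) \<le> 1" using pi_ge_two by (simp add: divide_le_eq_1)
    show "\<bar>z $ j\<bar> / (norm z)\<^sup>2 \<le> 1 / norm z"
      using component_le_norm_cart[of z j] False by (simp add: divide_simps power2_eq_square)
  qed auto
  also have "1 / norm z \<le> 1 + sing_kernel z"
    by (cases "norm z \<le> 1") (auto simp: sing_kernel_def divide_le_eq_1)
  finally show ?thesis by simp
qed (simp add: G_def sing_kernel_def)

lemma Apot_measurable [measurable]:
  assumes [measurable]: "u \<in> borel_measurable borel"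
  shows "Apot j u \<in> borel_measurable borel"
proof -
  have [measurable]: "G i \<in> borel_measurable borel" for i
    unfolding G_def by measurable
  have "(\<lambda>x. LINT y|lborel. G i (x - y) * (cmod (u y))\<^sup>2) \<in> borel_measurable borel" for i
    by (rule lborel.borel_measurable_lebesgue_integral) measurable
  then have "(\<lambda>x. c * (LINT y|lborel. G i (x - y) * (cmod (u y))\<^sup>2)) \<in> borel_measurable borel" for i c
    by (intro borel_measurable_times borel_measurable_const)
  then show ?thesis by (cases "j = 1") (simp_all add: Apot_def[abs_def])
qed

lemma ennreal_abs_Apot_le:
  assumes [measurable]: "u \<in> borel_measurable borel"
  shows "ennreal \<bar>Apot j u x\<bar> \<le> (\<integral>\<^sup>+y. ennreal ((cmod (u y))\<^sup>2) \<partial>lborel)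
     + (\<integral>\<^sup>+y. ennreal (sing_kernel (x - y)) * ennreal ((cmod (u y))\<^sup>2) \<partial>lborel)"
proof -
  have [measurable]: "G i \<in> borel_measurable borel" for i unfolding G_def by measurable
  obtain i where "\<bar>Apot j u x\<bar> = 1/2 * \<bar>LINT y|lborel. G i (x - y) * (cmod (u y))\<^sup>2\<bar>"
    unfolding Apot_def by (cases "j = 1") (auto simp: abs_mult)
  then have "\<bar>Apot j u x\<bar> \<le> \<bar>LINT y|lborel. G i (x - y) * (cmod (u y))\<^sup>2\<bar>" by simp
  then have "ennreal \<bar>Apot j u x\<bar> \<le> ennreal (norm (LINT y|lborel. G i (x - y) * (cmod (u y))\<^sup>2))" by (simp add: ennreal_leI)
  also have "\<dots> \<le> (\<integral>\<^sup>+y. ennreal (norm (G i (x - y) * (cmod (u y))\<^sup>2)) \<partial>lborel)"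
  \<comment> \<open>Without integrability the Bochner integral defining the potential is 0 and the
    bound is trivial.\<close>
  proof (cases "integrable lborel (\<lambda>y. G i (x - y) * (cmod (u y))\<^sup>2)")
    case True
    then show ?thesis by (rule integral_norm_bound_ennreal)
  qed (simp add: not_integrable_integral_eq)
  also have "\<dots> \<le> (\<integral>\<^sup>+y. ennreal ((cmod (u y))\<^sup>2) + ennreal (sing_kernel (x - y)) * ennreal ((cmod (u y))\<^sup>2) \<partial>lborel)"
  proof (rule nn_integral_mono)
    fix y
    have "norm (G i (x - y) * (cmod (u y))\<^sup>2) \<le> (1 + sing_kernel (x - y)) * (cmod (u y))\<^sup>2"
      using abs_G_le[of i "x - y"] by (simp add: abs_mult mult_right_mono)
    then have "ennreal (norm (G i (x - y) * (cmod (u y))\<^sup>2)) \<le> ennreal ((cmod (u y))\<^sup>2 + sing_kernel (x - y) * (cmod (u y))\<^sup>2)"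
      by (intro ennreal_leI) (simp add: algebra_simps)
    then show "ennreal (norm (G i (x - y) * (cmod (u y))\<^sup>2)) \<le> ennreal ((cmod (u y))\<^sup>2) + ennreal (sing_kernel (x - y)) * ennreal ((cmod (u y))\<^sup>2)"
      by (simp add: ennreal_plus ennreal_mult sing_kernel_nonneg)
  qed
  also have "\<dots> = (\<integral>\<^sup>+y. ennreal ((cmod (u y))\<^sup>2) \<partial>lborel) + (\<integral>\<^sup>+y. ennreal (sing_kernel (x - y)) * ennreal ((cmod (u y))\<^sup>2) \<partial>lborel)"
    by (rule nn_integral_add) auto
  finally show ?thesis .
qed

lemma ennreal_mult_le_cubes: "(a::ennreal)\<^sup>2 * b \<le> a ^ 3 + b ^ 3"
proof (cases "a \<le> b")
  case True
  then have "a\<^sup>2 * b \<le> b\<^sup>2 * b" by (intro mult_right_mono power_mono) auto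
  then show ?thesis by (simp add: power2_eq_square power3_eq_cube add_increasing)
next
  case False
  then have "a\<^sup>2 * b \<le> a\<^sup>2 * a" by (intro mult_left_mono) auto
  then show ?thesis by (simp add: power2_eq_square power3_eq_cube add_increasing2)
qed

text \<open>The crude constant 4 comes from replacing both summands by the larger one; only
  finiteness matters in its uses.\<close>

lemma ennreal_add_square_le: "((a::ennreal) + b)\<^sup>2 \<le> 4 * a\<^sup>2 + 4 * b\<^sup>2"
proof -
  have *: "(a + b)\<^sup>2 \<le> 4 * b\<^sup>2" if "a \<le> b" for a b :: ennreal
  proof -
    have "(a + b)\<^sup>2 \<le> (2 * b)\<^sup>2" using that by (intro power_mono) (auto simp: mult_2 add_right_mono)
    then show ?thesis by (simp add: power_mult_distrib)
  qed
  show ?thesis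
  proof (cases "a \<le> b")
    case True
    then show ?thesis using *[OF True] by (simp add: add_increasing)
  next
    case False
    then show ?thesis using *[of b a] by (simp add: add_increasing2 add.commute)
  qed
qed

text \<open>With \<rho> = |u|^2 the potential is at most m + K * \<rho> (convolution). The bounded
  part costs m^2 times the mass. For the other part, the integral of (K * \<rho>)^2 \<rho> is at
  most 2 \<kappa>^2 times that of \<rho>^3, which is the L^6 hypothesis.\<close>

lemma l2_Apot_mult:
  assumes u: "l2 u" and u6: "(\<integral>\<^sup>+x. ennreal (cmod (u x) ^ 6) \<partial>lborel) < \<infinity>"
  shows "l2 (\<lambda>x. \<i> * complex_of_real (Apot j u x) * u x)"
proof -
  note [measurable] = u[THEN l2_measurable]
  define \<rho> where "\<rho> = (\<lambda>x. ennreal ((cmod (u x))\<^sup>2))"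
  define K where "K = (\<lambda>z. ennreal (sing_kernel z))"
  define m where "m = (\<integral>\<^sup>+x. \<rho> x \<partial>lborel)"
  define R where "R = (\<integral>\<^sup>+x. \<rho> x ^ 3 \<partial>lborel)"
  define \<kappa> where "\<kappa> = (\<integral>\<^sup>+z. K z \<partial>lborel)"
  define B where "B = (\<lambda>x. \<integral>\<^sup>+y. K (x - y) * \<rho> y \<partial>lborel)"
  have [measurable]: "\<rho> \<in> borel_measurable borel" "K \<in> borel_measurable borel" "B \<in> borel_measurable borel"
    unfolding B_def \<rho>_def K_def by measurable
  have Kx: "(\<integral>\<^sup>+y. K (y - x) \<partial>lborel) = \<kappa>" for x
    using nn_integral_translate[of K "- x"] by (simp add: \<kappa>_def)
  have Ksym: "K (x - y) = K (y - x)" for x y by (simp add: K_def sing_kernel_minus)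
  have fin: "m < \<infinity>" "R < \<infinity>" "\<kappa> < \<infinity>"
    using u u6 nn_integral_sing_kernel by (simp_all add: m_def R_def \<kappa>_def \<rho>_def K_def l2_def ennreal_power flip: power_mult)
  have Bsq: "(B x)\<^sup>2 \<le> \<kappa> * (\<integral>\<^sup>+y. K (x - y) * \<rho> y ^ 2 \<partial>lborel)" for x
  proof -
    \<comment> \<open>Splitting K into two square roots makes Cauchy-Schwarz give (K * \<rho>)^2
      \<le> \<kappa> (K * \<rho>^2), which retains the integrable kernel.\<close>
    define L where "L = (\<lambda>z. ennreal (sqrt (sing_kernel z)))"
    have [measurable]: "L \<in> borel_measurable borel" unfolding L_def by measurable
    have L2: "L z * L z = K z" for z
      unfolding L_def K_def by (simp add: sing_kernel_nonneg flip: ennreal_mult)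
    have "B x = (\<integral>\<^sup>+y. L (x - y) * (L (x - y) * \<rho> y) \<partial>lborel)"
      unfolding B_def by (simp add: L2 flip: mult.assoc)
    then have "(B x)\<^sup>2 \<le> (\<integral>\<^sup>+y. L (x - y) ^ 2 \<partial>lborel) * (\<integral>\<^sup>+y. (L (x - y) * \<rho> y) ^ 2 \<partial>lborel)"
      using Cauchy_Schwarz_nn_integral[of "\<lambda>y. L (x - y)" lborel "\<lambda>y. L (x - y) * \<rho> y"] by simp
    also have "(\<integral>\<^sup>+y. L (x - y) ^ 2 \<partial>lborel) = \<kappa>"
      using Kx[of x] by (simp add: power2_eq_square L2 Ksym[of x])
    also have "(\<integral>\<^sup>+y. (L (x - y) * \<rho> y) ^ 2 \<partial>lborel) = (\<integral>\<^sup>+y. K (x - y) * \<rho> y ^ 2 \<partial>lborel)"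
      by (simp add: power_mult_distrib L2 power2_eq_square[of "L _"])
    finally show ?thesis .
  qed
  have "(\<integral>\<^sup>+x. (B x)\<^sup>2 * \<rho> x \<partial>lborel) \<le> (\<integral>\<^sup>+x. (\<kappa> * (\<integral>\<^sup>+y. K (x - y) * \<rho> y ^ 2 \<partial>lborel)) * \<rho> x \<partial>lborel)"
    by (intro nn_integral_mono mult_right_mono Bsq) auto
  also have "\<dots> = \<kappa> * (\<integral>\<^sup>+x. (\<integral>\<^sup>+y. K (x - y) * (\<rho> y ^ 2 * \<rho> x) \<partial>lborel) \<partial>lborel)"
    by (simp add: nn_integral_cmult nn_integral_multc mult.assoc flip: nn_integral_multc)
  \<comment> \<open>Decoupling \<rho>(y)^2 \<rho>(x) into cubes lets K be integrated out in
    whichever variable the cube does not contain.\<close>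
  also have "\<dots> \<le> \<kappa> * (\<integral>\<^sup>+x. (\<integral>\<^sup>+y. K (x - y) * \<rho> y ^ 3 + K (x - y) * \<rho> x ^ 3 \<partial>lborel) \<partial>lborel)"
    by (intro mult_left_mono nn_integral_mono) (auto simp: ennreal_mult_le_cubes mult_left_mono simp flip: distrib_left)
  also have "\<dots> = \<kappa> * ((\<integral>\<^sup>+x. (\<integral>\<^sup>+y. K (x - y) * \<rho> y ^ 3 \<partial>lborel) \<partial>lborel) + (\<integral>\<^sup>+x. (\<integral>\<^sup>+y. K (x - y) * \<rho> x ^ 3 \<partial>lborel) \<partial>lborel))"
    by (simp add: nn_integral_add)
  also have "(\<integral>\<^sup>+x. (\<integral>\<^sup>+y. K (x - y) * \<rho> y ^ 3 \<partial>lborel) \<partial>lborel) = (\<integral>\<^sup>+y. (\<integral>\<^sup>+x. K (x - y) * \<rho> y ^ 3 \<partial>lborel) \<partial>lborel)"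
    by (rule lborel_pair.Fubini'[symmetric]) measurable
  also have "\<dots> = \<kappa> * R"
    by (simp add: nn_integral_multc Kx nn_integral_cmult R_def)
  also have "(\<integral>\<^sup>+x. (\<integral>\<^sup>+y. K (x - y) * \<rho> x ^ 3 \<partial>lborel) \<partial>lborel) = \<kappa> * R"
    by (subst Ksym) (simp add: nn_integral_multc Kx nn_integral_cmult R_def)
  also have "\<kappa> * (\<kappa> * R + \<kappa> * R) < \<infinity>"
    using fin by (auto simp: ennreal_mult_less_top)
  finally have B: "(\<integral>\<^sup>+x. (B x)\<^sup>2 * \<rho> x \<partial>lborel) < \<infinity>" .
  have "(\<integral>\<^sup>+x. ennreal ((cmod (\<i> * complex_of_real (Apot j u x) * u x))\<^sup>2) \<partial>lborel)
     \<le> (\<integral>\<^sup>+x. 4 * m\<^sup>2 * \<rho> x + 4 * ((B x)\<^sup>2 * \<rho> x) \<partial>lborel)"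
  proof (rule nn_integral_mono)
    fix x
    have "ennreal ((cmod (\<i> * complex_of_real (Apot j u x) * u x))\<^sup>2) = (ennreal \<bar>Apot j u x\<bar>)\<^sup>2 * \<rho> x"
      unfolding \<rho>_def by (simp add: norm_mult power_mult_distrib ennreal_mult ennreal_power)
    also have "\<dots> \<le> (m + B x)\<^sup>2 * \<rho> x"
      using ennreal_abs_Apot_le[of u j x] unfolding m_def B_def K_def \<rho>_def by (intro mult_right_mono power_mono) auto
    also have "\<dots> \<le> (4 * m\<^sup>2 + 4 * (B x)\<^sup>2) * \<rho> x" by (intro mult_right_mono ennreal_add_square_le) auto
    finally show "ennreal ((cmod (\<i> * complex_of_real (Apot j u x) * u x))\<^sup>2) \<le> 4 * m\<^sup>2 * \<rho> x + 4 * ((B x)\<^sup>2 * \<rho> x)"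
      by (simp add: distrib_right mult.assoc)
  qed
  also have "\<dots> = 4 * m\<^sup>2 * m + 4 * (\<integral>\<^sup>+x. (B x)\<^sup>2 * \<rho> x \<partial>lborel)"
    by (simp add: nn_integral_add nn_integral_cmult m_def)
  also have "\<dots> < \<infinity>"
    using fin B by (auto simp: ennreal_mult_less_top power_less_top_ennreal)
  finally show ?thesis unfolding l2_def by simp
qed

subsection \<open>Global existence\<close>

definition kin :: "(2 \<Rightarrow> cfun) \<Rightarrow> real" where
  "kin D = (LINT x|lborel. (cmod (D 1 x))\<^sup>2 + (cmod (D 2 x))\<^sup>2)"

definition pmass :: "real \<Rightarrow> cfun \<Rightarrow> real" where
  "pmass p u = (LINT x|lborel. cmod (u x) powr p)"

definition mass :: "cfun \<Rightarrow> real" where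
  "mass u = (LINT x|lborel. (cmod (u x))\<^sup>2)"

lemma l2_integrable: "l2 f \<Longrightarrow> integrable lborel (\<lambda>x. (cmod (f x))\<^sup>2)"
  by (auto simp: l2_def integrable_iff_bounded)

lemma mass_nonneg: "mass u \<ge> 0" unfolding mass_def by (rule Bochner_Integration.integral_nonneg) simp

lemma pmass_nonneg: "pmass p u \<ge> 0" unfolding pmass_def by (rule Bochner_Integration.integral_nonneg) simp

lemma kin_nonneg: "kin D \<ge> 0" unfolding kin_def by (rule Bochner_Integration.integral_nonneg) simp

lemma nn_integral_mass: "l2 u \<Longrightarrow> (\<integral>\<^sup>+x. ennreal ((cmod (u x))\<^sup>2) \<partial>lborel) = ennreal (mass u)"
  unfolding mass_def by (rule nn_integral_eq_integral[OF l2_integrable]) auto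

lemma kin_eq: "l2 (D 1) \<Longrightarrow> l2 (D 2) \<Longrightarrow> kin D = mass (D 1) + mass (D 2)"
  unfolding kin_def mass_def by (intro Bochner_Integration.integral_add l2_integrable)

lemma mass_le_kin:
  assumes "\<And>j. l2 (D j)" shows "mass (D j) \<le> kin D"
proof -
  have "j = 1 \<or> j = 2" by (rule exhaust_2)
  then show ?thesis using kin_eq[of D] assms mass_nonneg[of "D 1"] mass_nonneg[of "D 2"] by auto
qed

section \<open>Gagliardo-Nirenberg with real-valued integrals and real exponents\<close>

lemma gagliardo_nirenberg_real:
  "\<exists>C\<ge>0. \<forall>u D. covariant_gradient u D \<longrightarrow> (\<forall>j. l2 (D j)) \<longrightarrow>
    integrable lborel (\<lambda>x. cmod (u x) ^ (2 * (m+1))) \<and>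
    (LINT x|lborel. cmod (u x) ^ (2 * (m+1))) \<le> C * (mass u * kin D ^ m)"
proof -
  obtain C :: real where C: "C \<ge> 0" "\<And>u D X. covariant_gradient u D \<Longrightarrow> (\<And>j. (\<integral>\<^sup>+x. ennreal ((cmod (D j x))\<^sup>2) \<partial>lborel) \<le> X) \<Longrightarrow>
    (\<integral>\<^sup>+x. ennreal (cmod (u x) ^ (2 * (m+1))) \<partial>lborel) \<le> ennreal C * ((\<integral>\<^sup>+x. ennreal ((cmod (u x))\<^sup>2) \<partial>lborel) * X ^ m)"
    using gagliardo_nirenberg[of m] by blast
  show ?thesis
  proof (intro exI[of _ C] conjI allI impI)
    fix u D assume D: "covariant_gradient u D" and l: "\<forall>j. l2 (D j)"
    have u: "l2 u" using D by (simp add: covariant_gradient_def)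
    note [measurable] = l2_measurable[OF u]
    have X: "(\<integral>\<^sup>+x. ennreal ((cmod (D j x))\<^sup>2) \<partial>lborel) \<le> ennreal (kin D)" for j
      using mass_le_kin[of D j] l by (simp add: nn_integral_mass ennreal_leI)
    have le: "(\<integral>\<^sup>+x. ennreal (cmod (u x) ^ (2 * (m+1))) \<partial>lborel) \<le> ennreal (C * (mass u * kin D ^ m))"
      using C(2)[OF D X] C(1) kin_nonneg[of D] mass_nonneg[of u]
      by (simp add: nn_integral_mass[OF u] ennreal_mult ennreal_power)
    show i: "integrable lborel (\<lambda>x. cmod (u x) ^ (2 * (m+1)))"
    proof (rule integrableI_bounded)
      show "(\<integral>\<^sup>+x. ennreal (norm (cmod (u x) ^ (2 * (m+1)))) \<partial>lborel) < \<infinity>"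
        using le by (simp add: le_less_trans)
    qed measurable
    show "(LINT x|lborel. cmod (u x) ^ (2 * (m+1))) \<le> C * (mass u * kin D ^ m)"
    proof (rule ennreal_le_iff[THEN iffD1])
      show "0 \<le> C * (mass u * kin D ^ m)" using C(1) kin_nonneg[of D] mass_nonneg[of u] by simp
      show "ennreal (LINT x|lborel. cmod (u x) ^ (2 * (m+1))) \<le> ennreal (C * (mass u * kin D ^ m))"
        using le nn_integral_eq_integral[OF i] by simp
    qed
  qed (rule C(1))
qed

text \<open>Below the height s the exponent is lowered to 2, above it raised to 2(m+1). Keeping s
  free allows one coefficient to be made small.\<close>

lemma powr_le_interpolate:
  assumes "0 \<le> r" "0 < s" "2 \<le> p" "p \<le> real (2 * (m+1))"
  shows "r powr p \<le> s powr (p - 2) * r\<^sup>2 + s powr (p - real (2 * (m+1))) * r ^ (2 * (m+1))"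
proof (cases "r = 0")
  case False
  then have r: "r > 0" using assms by simp
  have nn: "0 \<le> s powr (p - 2) * r\<^sup>2" "0 \<le> s powr (p - real (2 * (m+1))) * r ^ (2 * (m+1))" using r by simp_all
  show ?thesis
  proof (cases "r \<le> s")
    case True
    have "r powr p = r powr (p - 2) * r powr 2" by (subst powr_add[symmetric]) simp
    also have "r powr 2 = r\<^sup>2" using r by (simp add: powr_numeral)
    also have "r powr (p - 2) * r\<^sup>2 \<le> s powr (p - 2) * r\<^sup>2"
      using True assms r by (intro mult_mono powr_mono2) auto
    finally show ?thesis using nn by linarith
  next
    case False
    have "r powr p = r powr (p - real (2 * (m+1))) * r powr (real (2 * (m+1)))" by (subst powr_add[symmetric]) simp
    also have "r powr (real (2 * (m+1))) = r ^ (2 * (m+1))" using r by (rule powr_realpow)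
    also have "r powr (p - real (2 * (m+1))) * r ^ (2 * (m+1)) \<le> s powr (p - real (2 * (m+1))) * r ^ (2 * (m+1))"
      using False assms r by (intro mult_right_mono powr_mono2') auto
    finally show ?thesis using nn by linarith
  qed
qed (use assms in simp)

text \<open>\<open>C\<close> is fixed before \<open>u\<close>, \<open>D\<close> and
  \<open>s\<close>, so the height can later be adapted to \<open>C\<close> and to the conserved
  mass.\<close>

lemma pmass_le:
  assumes "2 \<le> p" "p \<le> real (2 * (m+1))"
  shows "\<exists>C\<ge>0. \<forall>u D. covariant_gradient u D \<longrightarrow> (\<forall>j. l2 (D j)) \<longrightarrow>
    integrable lborel (\<lambda>x. cmod (u x) powr p) \<and>
    (\<forall>s>0. pmass p u \<le> s powr (p - 2) * mass u + s powr (p - real (2 * (m+1))) * (C * (mass u * kin D ^ m)))"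
proof -
  obtain C :: real where C: "C \<ge> 0" "\<And>u D. covariant_gradient u D \<Longrightarrow> (\<And>j. l2 (D j)) \<Longrightarrow>
    integrable lborel (\<lambda>x. cmod (u x) ^ (2 * (m+1))) \<and>
    (LINT x|lborel. cmod (u x) ^ (2 * (m+1))) \<le> C * (mass u * kin D ^ m)"
    using gagliardo_nirenberg_real[of m] by blast
  show ?thesis
  proof (intro exI[of _ C] conjI allI impI)
    fix u D assume D: "covariant_gradient u D" and l: "\<forall>j. l2 (D j)"
    have u: "l2 u" using D by (simp add: covariant_gradient_def)
    note [measurable] = l2_measurable[OF u]
    note i2 = l2_integrable[OF u]
    note i4 = C(2)[OF D l[rule_format], THEN conjunct1]
    have i: "integrable lborel (\<lambda>x. s powr (p - 2) * (cmod (u x))\<^sup>2 + s powr (p - real (2 * (m+1))) * cmod (u x) ^ (2 * (m+1)))" for s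
      by (intro Bochner_Integration.integrable_add integrable_mult_right i2 i4)
    show ip: "integrable lborel (\<lambda>x. cmod (u x) powr p)"
    proof (rule Bochner_Integration.integrable_bound[OF i[of 1]])
      show "AE x in lborel. norm (cmod (u x) powr p) \<le>
          norm (1 powr (p - 2) * (cmod (u x))\<^sup>2 + 1 powr (p - real (2 * (m+1))) * cmod (u x) ^ (2 * (m+1)))"
        using powr_le_interpolate[OF norm_ge_zero zero_less_one assms] by (intro AE_I2) (auto intro: order_trans[OF _ abs_ge_self])
    qed measurable
    fix s :: real assume s: "s > 0"
    have "pmass p u \<le> (LINT x|lborel. s powr (p - 2) * (cmod (u x))\<^sup>2 + s powr (p - real (2 * (m+1))) * cmod (u x) ^ (2 * (m+1)))"
      unfolding pmass_def by (rule integral_mono[OF ip i]) (rule powr_le_interpolate[OF norm_ge_zero s assms])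
    also have "\<dots> = s powr (p - 2) * mass u + s powr (p - real (2 * (m+1))) * (LINT x|lborel. cmod (u x) ^ (2 * (m+1)))"
      unfolding mass_def using i2 i4 by (subst Bochner_Integration.integral_add) auto
    also have "\<dots> \<le> s powr (p - 2) * mass u + s powr (p - real (2 * (m+1))) * (C * (mass u * kin D ^ m))"
      using C(2)[OF D l[rule_format]] by (intro add_left_mono mult_left_mono) auto
    finally show "pmass p u \<le> s powr (p - 2) * mass u + s powr (p - real (2 * (m+1))) * (C * (mass u * kin D ^ m))" .
  qed (rule C(1))
qed

section \<open>H^1 functions and their covariant derivatives\<close>

lemma wd_props: "H1 u \<Longrightarrow> l2 (wd j u) \<and> weak_pd j u (wd j u)"
proof -
  assume "H1 u"
  then have "\<exists>g. sq_int g \<and> weak_pd j u g" by (simp add: H1_def)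
  then have "sq_int (wd j u) \<and> weak_pd j u (wd j u)" unfolding wd_def by (rule someI_ex)
  then show ?thesis by (simp add: sq_int_iff_l2)
qed

lemma H1_l2: "H1 u \<Longrightarrow> l2 u" by (simp add: H1_def sq_int_iff_l2)

lemma covariant_gradient_wd: "H1 u \<Longrightarrow> covariant_gradient u (\<lambda>j. wd j u)"
  unfolding covariant_gradient_def using wd_props H1_l2 l2_measurable by blast

lemma l2_add:
  assumes "l2 f" "l2 g" shows "l2 (\<lambda>x. f x + g x)"
proof -
  note [measurable] = assms[THEN l2_measurable]
  have "(\<integral>\<^sup>+x. ennreal ((cmod (f x + g x))\<^sup>2) \<partial>lborel)
     \<le> (\<integral>\<^sup>+x. 4 * ennreal ((cmod (f x))\<^sup>2) + 4 * ennreal ((cmod (g x))\<^sup>2) \<partial>lborel)"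
  proof (rule nn_integral_mono)
    fix x
    have "(ennreal (cmod (f x + g x)))\<^sup>2 \<le> (ennreal (cmod (f x)) + ennreal (cmod (g x)))\<^sup>2"
      by (intro power_mono) (auto simp: norm_triangle_ineq ennreal_leI simp flip: ennreal_plus)
    also have "\<dots> \<le> 4 * (ennreal (cmod (f x)))\<^sup>2 + 4 * (ennreal (cmod (g x)))\<^sup>2"
      by (rule ennreal_add_square_le)
    finally show "ennreal ((cmod (f x + g x))\<^sup>2) \<le> 4 * ennreal ((cmod (f x))\<^sup>2) + 4 * ennreal ((cmod (g x))\<^sup>2)"
      by (simp add: ennreal_power)
  qed
  also have "\<dots> < \<infinity>" using assms by (simp add: nn_integral_add nn_integral_cmult l2_def ennreal_mult_less_top)
  finally show ?thesis by (simp add: l2_def)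
qed

text \<open>The case m = 2 of the inequality, applied to the plain weak gradient, gives u in L^6, as
  \<open>l2_Apot_mult\<close> demands.\<close>

lemma l2_Dcov:
  assumes "H1 u" shows "l2 (Dcov j u)"
proof -
  obtain C :: real where C: "\<And>u D. covariant_gradient u D \<Longrightarrow> (\<And>j. l2 (D j)) \<Longrightarrow> integrable lborel (\<lambda>x. cmod (u x) ^ (2 * (2+1)))"
    using gagliardo_nirenberg_real[of 2] by blast
  have "integrable lborel (\<lambda>x. cmod (u x) ^ 6)"
    using C[OF covariant_gradient_wd[OF assms]] wd_props[OF assms] by simp
  then have "(\<integral>\<^sup>+x. ennreal (cmod (u x) ^ 6) \<partial>lborel) < \<infinity>"
    by (simp add: integrable_iff_bounded)
  from l2_add[OF wd_props[OF assms, THEN conjunct1] l2_Apot_mult[OF H1_l2[OF assms] this]]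
  show ?thesis by (simp add: Dcov_def[abs_def])
qed

lemma covariant_gradient_Dcov:
  assumes "H1 u" shows "covariant_gradient u (\<lambda>j. Dcov j u)"
proof -
  have "Re (cnj (u x) * wd j u x) = Re (cnj (u x) * Dcov j u x)" for j x
    by (simp add: Dcov_def algebra_simps)
  then show ?thesis
    unfolding covariant_gradient_def using wd_props[OF assms] H1_l2[OF assms] l2_Dcov[OF assms] l2_measurable by blast
qed

text \<open>\<open>wd\<close> is a choice by \<open>SOME\<close>; the difference of the two choices
  serves as a witness, and no formula for \<open>wd\<close> of the difference is claimed.\<close>

lemma H1_diff:
  assumes "H1 u" "H1 v" shows "H1 (\<lambda>x. u x - v x)"
proof -
  have neg: "l2 (\<lambda>x. - f x)" if "l2 f" for f :: cfun using that by (simp add: l2_def)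
  have d: "l2 (\<lambda>x. f x - g x)" if "l2 f" "l2 g" for f g :: cfun using l2_add[OF that(1) neg[OF that(2)]] by simp
  have "weak_pd j (\<lambda>x. u x - v x) (\<lambda>x. wd j u x - wd j v x)" for j
    unfolding weak_pd_def
  proof (intro allI impI)
    fix \<psi> assume t: "test_fun \<psi>"
    note i = l2_integrable_mult[OF _ test_fun_l2(1)[OF t]] l2_integrable_mult[OF _ test_fun_l2(2)[OF t]]
    have "(LINT x|lborel. u x * of_real (partial j \<psi> x)) = - (LINT x|lborel. wd j u x * of_real (\<psi> x))"
      "(LINT x|lborel. v x * of_real (partial j \<psi> x)) = - (LINT x|lborel. wd j v x * of_real (\<psi> x))"
      using wd_props[OF assms(1), of j] wd_props[OF assms(2), of j] t by (auto simp: weak_pd_def)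
    then show "(LINT x|lborel. (u x - v x) * of_real (partial j \<psi> x)) = - (LINT x|lborel. (wd j u x - wd j v x) * of_real (\<psi> x))"
      using i wd_props[OF assms(1), of j] wd_props[OF assms(2), of j] assms[THEN H1_l2]
      by (simp add: left_diff_distrib)
  qed
  then show ?thesis
    unfolding H1_def sq_int_iff_l2 using d assms[THEN H1_l2] wd_props[OF assms(1)] wd_props[OF assms(2)] by blast
qed

lemma H1norm_eq: "H1 u \<Longrightarrow> H1norm u = sqrt (mass u + kin (\<lambda>j. wd j u))"
  using wd_props by (simp add: H1norm_def mass_def[symmetric] kin_eq add.assoc)

lemma Energy_eq: "Energy lam p u = kin (\<lambda>j. Dcov j u) / 2 - lam / p * pmass p u"
  by (simp add: Energy_def kin_def pmass_def)

lemma Qf_eq: "Qf lam p u = kin (\<lambda>j. Dcov j u) - lam * (p - 2) / p * pmass p u"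
  by (simp add: Qf_def kin_def pmass_def)

lemma Qf_eq_Energy: "p \<noteq> 0 \<Longrightarrow> Qf lam p u = 2 * Energy lam p u - lam * (p - 4) / p * pmass p u"
  by (simp add: Qf_eq Energy_eq field_simps)

lemma L2norm_eq: "L2norm u = sqrt (mass u)" by (simp add: L2norm_def mass_def)

text \<open>The set \<open>b \<le> \<tau> a\<close> contributes the first term, its complement the second.\<close>

lemma powr_add_le_perturb:
  assumes "p > 0" "\<delta> > 0"
  shows "\<exists>\<beta>\<ge>0. \<forall>a b::real. 0 \<le> a \<longrightarrow> 0 \<le> b \<longrightarrow> (a + b) powr p \<le> (1 + \<delta>) * a powr p + \<beta> * b powr p"
proof -
  \<comment> \<open>Chosen so that (1 + \<tau>)^p = 1 + \<delta>.\<close>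
  define \<tau> where "\<tau> = (1 + \<delta>) powr (1/p) - 1"
  have "1 powr (1/p) < (1 + \<delta>) powr (1/p)" using assms by (intro powr_less_mono2) auto
  then have \<tau>: "\<tau> > 0" by (simp add: \<tau>_def)
  have \<tau>p: "(1 + \<tau>) powr p = 1 + \<delta>" using assms by (simp add: \<tau>_def powr_powr)
  show ?thesis
  proof (intro exI[of _ "(1 / \<tau> + 1) powr p"] conjI allI impI)
    fix a b :: real assume ab: "0 \<le> a" "0 \<le> b"
    show "(a + b) powr p \<le> (1 + \<delta>) * a powr p + (1 / \<tau> + 1) powr p * b powr p"
    proof (cases "b \<le> \<tau> * a")
      case True
      have "(a + b) powr p \<le> ((1 + \<tau>) * a) powr p"
        using True ab assms by (intro powr_mono2) (auto simp: algebra_simps)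
      also have "\<dots> = (1 + \<delta>) * a powr p" using ab \<tau> by (simp add: powr_mult \<tau>p)
      finally show ?thesis by (simp add: add_increasing2)
    next
      case False
      then have "a \<le> b / \<tau>" using \<tau> by (simp add: field_simps)
      then have "(a + b) powr p \<le> ((1 / \<tau> + 1) * b) powr p"
        using ab assms by (intro powr_mono2) (auto simp: algebra_simps)
      also have "\<dots> = (1 / \<tau> + 1) powr p * b powr p" using ab \<tau> by (simp add: powr_mult)
      finally show ?thesis using assms by (simp add: add_increasing)
    qed
  qed simp
qed

section \<open>Continuity of the L^p integral under H^1 convergence\<close>

lemma ex_even_exponent: "\<exists>m. p \<le> real (2 * (m+1))"
proof -
  obtain n :: nat where "p \<le> n" using real_arch_simple by blast
  then show ?thesis by (intro exI[of _ n]) auto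
qed

lemma integrable_powr_H1:
  assumes "2 \<le> p" "H1 u" shows "integrable lborel (\<lambda>x. cmod (u x) powr p)"
proof -
  obtain m where "p \<le> real (2 * (m+1))" using ex_even_exponent by blast
  from pmass_le[OF assms(1) this] show ?thesis
    using covariant_gradient_wd[OF assms(2)] wd_props[OF assms(2)] by blast
qed

text \<open>Interpolation at height 1 with the plain weak gradient bounds \<open>pmass p\<close> by
  a polynomial in the squared H^1 norm that vanishes at 0.\<close>

lemma pmass_tendsto_0:
  assumes p: "2 \<le> p" and w: "\<forall>\<^sub>F s in F. H1 (w s)" and lim: "((\<lambda>s. H1norm (w s)) \<longlongrightarrow> 0) F"
  shows "((\<lambda>s. pmass p (w s)) \<longlongrightarrow> 0) F"
proof -
  obtain m where m: "p \<le> real (2 * (m+1))" using ex_even_exponent by blast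
  obtain C :: real where C: "C \<ge> 0" "\<And>u D s. covariant_gradient u D \<Longrightarrow> (\<And>j. l2 (D j)) \<Longrightarrow> s > 0 \<Longrightarrow>
    pmass p u \<le> s powr (p - 2) * mass u + s powr (p - real (2 * (m+1))) * (C * (mass u * kin D ^ m))"
    using pmass_le[OF p m] by blast
  define h where "h = (\<lambda>s. H1norm (w s)^2 + C * (H1norm (w s)^2 * (H1norm (w s)^2)^m))"
  have le_h: "\<forall>\<^sub>F s in F. pmass p (w s) \<le> h s"
    using w
  proof (rule eventually_mono)
    fix s assume H: "H1 (w s)"
    define \<eta> where "\<eta> = H1norm (w s)^2"
    have \<eta>: "\<eta> = mass (w s) + kin (\<lambda>j. wd j (w s))"
      unfolding \<eta>_def H1norm_eq[OF H] using mass_nonneg kin_nonneg by simp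
    have le: "mass (w s) \<le> \<eta>" "kin (\<lambda>j. wd j (w s)) \<le> \<eta>" "\<eta> \<ge> 0"
      using \<eta> mass_nonneg[of "w s"] kin_nonneg[of "\<lambda>j. wd j (w s)"] by linarith+
    have "pmass p (w s) \<le> mass (w s) + C * (mass (w s) * kin (\<lambda>j. wd j (w s)) ^ m)"
      using C(2)[OF covariant_gradient_wd[OF H], of 1] wd_props[OF H] by simp
    also have "\<dots> \<le> \<eta> + C * (\<eta> * \<eta>^m)"
      using le C(1) mass_nonneg kin_nonneg by (intro add_mono mult_left_mono mult_mono power_mono) auto
    finally show "pmass p (w s) \<le> h s" unfolding \<eta>_def h_def .
  qed
  have "(h \<longlongrightarrow> 0^2 + C * (0^2 * (0^2)^m)) F"
    unfolding h_def by (intro tendsto_intros lim)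
  then have h0: "(h \<longlongrightarrow> 0) F" by simp
  have "\<forall>\<^sub>F s in F. 0 \<le> pmass p (w s)" by (simp add: pmass_nonneg)
  from tendsto_sandwich[OF this le_h tendsto_const h0] show ?thesis .
qed

text \<open>Takes the place of Minkowski's inequality: it compares p-th powers directly, with a
  factor arbitrarily close to 1.\<close>

lemma pmass_perturb:
  assumes "2 \<le> p" "\<delta> > 0"
  shows "\<exists>\<beta>\<ge>0. \<forall>u v. H1 u \<longrightarrow> H1 v \<longrightarrow> pmass p u \<le> (1 + \<delta>) * pmass p v + \<beta> * pmass p (\<lambda>x. u x - v x)"
proof -
  obtain \<beta> where \<beta>: "\<beta> \<ge> 0" "\<And>a b::real. 0 \<le> a \<Longrightarrow> 0 \<le> b \<Longrightarrow> (a + b) powr p \<le> (1 + \<delta>) * a powr p + \<beta> * b powr p"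
    using powr_add_le_perturb[of p \<delta>] assms by auto
  show ?thesis
  proof (intro exI[of _ \<beta>] conjI allI impI)
    fix u v assume uv: "H1 u" "H1 v"
    note i = integrable_powr_H1[OF assms(1)]
    have "pmass p u \<le> (LINT x|lborel. (1 + \<delta>) * cmod (v x) powr p + \<beta> * cmod (u x - v x) powr p)"
      unfolding pmass_def
    proof (rule integral_mono)
      fix x
      have "cmod (u x) powr p \<le> (cmod (v x) + cmod (u x - v x)) powr p"
        using assms norm_triangle_ineq[of "v x" "u x - v x"] by (intro powr_mono2) auto
      also have "\<dots> \<le> (1 + \<delta>) * cmod (v x) powr p + \<beta> * cmod (u x - v x) powr p" by (rule \<beta>(2)) auto
      finally show "cmod (u x) powr p \<le> (1 + \<delta>) * cmod (v x) powr p + \<beta> * cmod (u x - v x) powr p" .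
    qed (use i uv H1_diff[OF uv] in \<open>auto intro!: Bochner_Integration.integrable_add integrable_mult_right\<close>)
    also have "\<dots> = (1 + \<delta>) * pmass p v + \<beta> * pmass p (\<lambda>x. u x - v x)"
      unfolding pmass_def using i uv H1_diff[OF uv] by (subst Bochner_Integration.integral_add) auto
    finally show "pmass p u \<le> (1 + \<delta>) * pmass p v + \<beta> * pmass p (\<lambda>x. u x - v x)" .
  qed (rule \<beta>(1))
qed

lemma pmass_tendsto:
  assumes p: "2 \<le> p" and v: "H1 v" and u: "\<forall>\<^sub>F s in F. H1 (u s)"
    and lim: "((\<lambda>s. H1norm (\<lambda>x. u s x - v x)) \<longlongrightarrow> 0) F"
  shows "((\<lambda>s. pmass p (u s)) \<longlongrightarrow> pmass p v) F"
proof (rule tendstoI)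
  fix e :: real assume e: "e > 0"
  define n where "n = pmass p v"
  have n: "n \<ge> 0" unfolding n_def by (rule pmass_nonneg)
  \<comment> \<open>The bound e / (4 (n + 1)) gives 2 \<delta> n \<le> e / 2; the cap at 1 allows 1
    + \<delta> to be replaced by 2.\<close>
  define \<delta> where "\<delta> = min 1 (e / (4 * (n + 1)))"
  have \<delta>: "\<delta> > 0" "\<delta> \<le> 1" "\<delta> \<le> e / (4 * (n + 1))" using e n by (auto simp: \<delta>_def)
  have "2 * (\<delta> * n) \<le> 2 * (e / (4 * (n + 1)) * n)" using \<delta> n by (intro mult_left_mono mult_right_mono) auto
  also have "\<dots> = e/2 * (n / (n + 1))" using n by (simp add: field_simps)
  also have "\<dots> \<le> e/2 * 1" using n e by (intro mult_left_mono) auto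
  finally have \<delta>n: "2 * (\<delta> * n) \<le> e / 2" by simp
  obtain \<beta> where \<beta>: "\<beta> \<ge> 0" "\<And>u v. H1 u \<Longrightarrow> H1 v \<Longrightarrow> pmass p u \<le> (1 + \<delta>) * pmass p v + \<beta> * pmass p (\<lambda>x. u x - v x)"
    using pmass_perturb[OF p \<delta>(1)] by blast
  have "\<forall>\<^sub>F s in F. H1 (\<lambda>x. u s x - v x)" using u by eventually_elim (rule H1_diff[OF _ v])
  from pmass_tendsto_0[OF p this lim] have "((\<lambda>s. 2 * \<beta> * pmass p (\<lambda>x. u s x - v x)) \<longlongrightarrow> 2 * \<beta> * 0) F"
    by (intro tendsto_intros)
  then have "\<forall>\<^sub>F s in F. 2 * \<beta> * pmass p (\<lambda>x. u s x - v x) < e / 2"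
    by (rule order_tendstoD) (use e in simp)
  then show "\<forall>\<^sub>F s in F. dist (pmass p (u s)) (pmass p v) < e" using u
  proof eventually_elim
    case (elim s)
    define d where "d = pmass p (\<lambda>x. u s x - v x)"
    define k where "k = pmass p (u s)"
    have sym: "pmass p (\<lambda>x. v x - u s x) = d" unfolding d_def pmass_def by (simp add: norm_minus_commute)
    have 1: "k \<le> (1 + \<delta>) * n + \<beta> * d" using \<beta>(2)[OF elim(2) v] by (simp add: k_def n_def d_def)
    have 2: "n \<le> (1 + \<delta>) * k + \<beta> * d" using \<beta>(2)[OF v elim(2)] sym by (simp add: k_def n_def)
    have "\<beta> * d \<ge> 0" using \<beta>(1) pmass_nonneg by (simp add: d_def)
    have k: "k \<ge> 0" unfolding k_def by (rule pmass_nonneg)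
    have dd: "2 * (\<beta> * d) < e / 2" using elim by (simp add: d_def mult.assoc)
    \<comment> \<open>In the bound for n - k the small factor multiplies the varying quantity k, so
      k is first replaced through inequality \<open>1\<close>.\<close>
    have "\<delta> * k \<le> \<delta> * ((1 + \<delta>) * n + \<beta> * d)" using 1 \<delta> by (intro mult_left_mono) auto
    also have "\<dots> = (1 + \<delta>) * (\<delta> * n) + \<delta> * (\<beta> * d)" by (simp add: algebra_simps)
    also have "\<dots> \<le> 2 * (\<delta> * n) + 1 * (\<beta> * d)"
      using \<delta> n \<open>\<beta> * d \<ge> 0\<close> by (intro add_mono mult_right_mono) auto
    finally have "n - k \<le> 2 * (\<delta> * n) + 2 * (\<beta> * d)" using 2 by (simp add: algebra_simps)
    moreover have "k - n \<le> \<delta> * n + \<beta> * d" using 1 by (simp add: algebra_simps)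
    moreover have "\<delta> * n \<ge> 0" using \<delta> n by simp
    ultimately have "\<bar>k - n\<bar> < e" using \<delta>n dd \<open>\<beta> * d \<ge> 0\<close> by linarith
    then show ?case by (simp add: dist_real_def k_def n_def)
  qed
qed

section \<open>Exclusion of blow-up in the three regimes\<close>

lemma no_blowup:
  assumes sol: "max_sol lam p \<phi>0 T \<phi>"
    and bound: "\<And>t. 0 \<le> t \<Longrightarrow> ereal t < T \<Longrightarrow> kin (\<lambda>j. Dcov j (\<phi> t)) \<le> B"
  shows "T = \<infinity>"
proof (rule ccontr)
  assume "T \<noteq> \<infinity>"
  moreover have "T > 0" using sol by (simp add: max_sol_def)
  ultimately obtain \<tau> where T: "T = ereal \<tau>" "\<tau> > 0" by (cases T) auto
  have "filterlim (\<lambda>t. L2norm (Dcov 1 (\<phi> t)) + L2norm (Dcov 2 (\<phi> t))) at_top (at_left \<tau>)"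
    using sol T by (simp add: max_sol_def)
  \<comment> \<open>Each of the two norms is at most sqrt B, so their sum never reaches this
    threshold.\<close>
  then have "\<forall>\<^sub>F t in at_left \<tau>. 2 * sqrt B + 1 \<le> L2norm (Dcov 1 (\<phi> t)) + L2norm (Dcov 2 (\<phi> t))"
    by (simp add: filterlim_at_top)
  moreover have "\<forall>\<^sub>F t in at_left \<tau>. t \<in> {0<..<\<tau>}" by (rule eventually_at_left_real[OF T(2)])
  ultimately have "\<forall>\<^sub>F t in at_left \<tau>. False"
  proof eventually_elim
    case (elim t)
    then have t: "0 \<le> t" "ereal t < T" using T by auto
    then have "H1 (\<phi> t)" using sol by (simp add: max_sol_def)
    then have "mass (Dcov j (\<phi> t)) \<le> B" for j
      using mass_le_kin[of "\<lambda>j. Dcov j (\<phi> t)" j] l2_Dcov bound[OF t] by force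
    then have "L2norm (Dcov j (\<phi> t)) \<le> sqrt B" for j by (simp add: L2norm_eq)
    from this[of 1] this[of 2] elim show ?case by linarith
  qed
  then show False by (simp add: trivial_limit_at_left_real)
qed


lemma max_sol_slice:
  assumes "max_sol lam p \<phi>0 T \<phi>" "0 \<le> t" "ereal t < T"
  shows "H1 (\<phi> t)" "mass (\<phi> t) = mass \<phi>0" "Energy lam p (\<phi> t) = Energy lam p \<phi>0"
  using assms by (auto simp: max_sol_def L2norm_eq)

text \<open>The energy contains half of the kinetic term x; a nonlinear part taking at most a
  quarter leaves x / 4.\<close>

lemma quarter_absorb:
  fixes a b e x :: real
  assumes "a \<le> b + 1 / 4 * x" "e = x / 2 - a" shows "x \<le> 4 * (e + b)"
  using assms by (simp add: field_simps)

text \<open>With m = 1 the kinetic energy enters linearly with coefficient s^(p-4). As p - 4 < 0, a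
  suitable height makes that coefficient small for any conserved mass.\<close>

lemma global_subcritical:
  assumes "lam > 0" "p > 2" "p < 4" and sol: "max_sol lam p \<phi>0 T \<phi>"
  shows "T = \<infinity>"
proof -
  obtain C where C: "C \<ge> 0" "\<And>u D s. covariant_gradient u D \<Longrightarrow> (\<And>j. l2 (D j)) \<Longrightarrow> s > 0 \<Longrightarrow>
    pmass p u \<le> s powr (p - 2) * mass u + s powr (p - 4) * (C * (mass u * kin D))"
    using pmass_le[of p 1] assms by auto
  define c where "c = mass \<phi>0"
  have c: "c \<ge> 0" unfolding c_def by (rule mass_nonneg)
  define k where "k = (lam / p) * (C * c)"
  \<comment> \<open>Makes \<open>K\<close> positive and k / K \<le> 1/4; the height \<open>s\<close>
    below solves s^(p-4) = 1 / K.\<close>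
  define K where "K = 4 * k + 1"
  have "k \<ge> 0" using C c assms by (simp add: k_def)
  then have K: "K > 0" by (simp add: K_def)
  define s where "s = K powr (1 / (4 - p))"
  have s: "s > 0" using K by (simp add: s_def)
  have "s powr (p - 4) = K powr (1 / (4 - p) * (p - 4))" by (simp add: s_def powr_powr)
  also have "1 / (4 - p) * (p - 4) = -1" using assms by (simp add: field_simps)
  also have "K powr -1 = 1 / K" using K by (simp add: powr_minus_divide)
  finally have sK: "s powr (p - 4) = 1 / K" .
  define B where "B = 4 * (Energy lam p \<phi>0 + lam / p * (s powr (p - 2) * c))"
  show ?thesis
  proof (rule no_blowup[OF sol])
    fix t :: real assume t: "0 \<le> t" "ereal t < T"
    note m = max_sol_slice[OF sol t]
    define X where "X = kin (\<lambda>j. Dcov j (\<phi> t))"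
    have X: "X \<ge> 0" unfolding X_def by (rule kin_nonneg)
    have "pmass p (\<phi> t) \<le> s powr (p - 2) * c + 1 / K * (C * (c * X))"
      using C(2)[OF covariant_gradient_Dcov[OF m(1)] l2_Dcov[OF m(1)] s] m(2) by (simp add: sK X_def c_def)
    then have "lam / p * pmass p (\<phi> t) \<le> lam / p * (s powr (p - 2) * c + 1 / K * (C * (c * X)))"
      using assms by (intro mult_left_mono) auto
    also have "\<dots> = lam / p * (s powr (p - 2) * c) + k / K * X"
      by (simp add: k_def distrib_left mult_ac)
    also have "k / K * X \<le> 1 / 4 * X"
    proof (intro mult_right_mono X)
      have "k \<le> 1 / 4 * K" by (simp add: K_def)
      then show "k / K \<le> 1 / 4" using K by (simp add: pos_divide_le_eq)
    qed
    finally have "lam / p * pmass p (\<phi> t) \<le> lam / p * (s powr (p - 2) * c) + 1 / 4 * X" by simp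
    moreover have "Energy lam p \<phi>0 = X / 2 - lam / p * pmass p (\<phi> t)"
      using m(3) by (simp add: Energy_eq X_def)
    ultimately show "kin (\<lambda>j. Dcov j (\<phi> t)) \<le> B" unfolding X_def[symmetric] B_def by (rule quarter_absorb)
  qed
qed

lemma global_critical:
  assumes "lam > 0"
  shows "\<exists>c0>0. \<forall>\<phi>0 T \<phi>. max_sol lam 4 \<phi>0 T \<phi> \<longrightarrow> L2norm \<phi>0 < c0 \<longrightarrow> T = \<infinity>"
proof -
  have "(2::real) \<le> 4" "4 \<le> real (2 * (1 + 1))" by simp_all
  from pmass_le[OF this] obtain C where C: "C \<ge> 0" "\<And>u D s. covariant_gradient u D \<Longrightarrow> (\<And>j. l2 (D j)) \<Longrightarrow> s > 0 \<Longrightarrow>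
    pmass 4 u \<le> s powr (4 - 2) * mass u + s powr (4 - real (2 * (1 + 1))) * (C * (mass u * kin D ^ 1))"
    by blast
  have K: "lam * C + 1 > 0" using assms C by (simp add: add_nonneg_pos)
  show ?thesis
  \<comment> \<open>A mass c below 1 / (lam C + 1) gives lam C c \<le> 1, so the coefficient lam C c
    / 4 of the kinetic term is at most 1/4. The 1 in the denominator covers C = 0.\<close>
  proof (intro exI[of _ "sqrt (1 / (lam * C + 1))"] conjI allI impI)
    fix \<phi>0 T \<phi> assume sol: "max_sol lam 4 \<phi>0 T \<phi>" and small: "L2norm \<phi>0 < sqrt (1 / (lam * C + 1))"
    define c where "c = mass \<phi>0"
    have c: "c \<ge> 0" unfolding c_def by (rule mass_nonneg)
    have "c < 1 / (lam * C + 1)" using small by (simp add: L2norm_eq c_def)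
    then have "(lam * C + 1) * c < 1" using K by (simp add: field_simps)
    then have cC: "lam * C * c \<le> 1" using c by (simp add: algebra_simps)
    show "T = \<infinity>"
    proof (rule no_blowup[OF sol])
      fix t :: real assume t: "0 \<le> t" "ereal t < T"
      note m = max_sol_slice[OF sol t]
      define X where "X = kin (\<lambda>j. Dcov j (\<phi> t))"
      have X: "X \<ge> 0" unfolding X_def by (rule kin_nonneg)
      have "pmass 4 (\<phi> t) \<le> c + C * (c * X)"
        using C(2)[OF covariant_gradient_Dcov[OF m(1)] l2_Dcov[OF m(1)] zero_less_one] m(2) by (simp add: X_def c_def)
      then have "lam / 4 * pmass 4 (\<phi> t) \<le> lam / 4 * (c + C * (c * X))"
        using assms by (intro mult_left_mono) auto
      also have "\<dots> = lam / 4 * c + (lam * C * c) * (X / 4)" by (simp add: algebra_simps)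
      also have "(lam * C * c) * (X / 4) \<le> 1 * (X / 4)"
        using cC X by (intro mult_right_mono) auto
      finally have "lam / 4 * pmass 4 (\<phi> t) \<le> lam / 4 * c + 1 / 4 * X" by simp
      moreover have "Energy lam 4 \<phi>0 = X / 2 - lam / 4 * pmass 4 (\<phi> t)"
        using m(3) by (simp add: Energy_eq X_def)
      ultimately show "kin (\<lambda>j. Dcov j (\<phi> t)) \<le> 4 * (Energy lam 4 \<phi>0 + lam / 4 * c)"
        unfolding X_def[symmetric] by (rule quarter_absorb)
    qed
  qed (use K in simp)
qed

text \<open>By conservation of energy, \<open>Qf\<close> along the flow is an affine function of \<open>pmass p (\<phi> t)\<close>, so its
  continuity needs only the Sobolev embedding into \<open>L\<^sup>p\<close>. It cannot vanish because the energy stays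
  below \<open>gamma_c\<close>.\<close>

lemma Qf_pos_along_flow:
  assumes p: "p > 2" and sol: "max_sol lam p \<phi>0 T \<phi>" and O: "\<phi>0 \<in> Oc lam p c"
    and t: "0 \<le> t" "ereal t < T"
  shows "Qf lam p (\<phi> t) > 0"
proof (rule ccontr)
  assume neg: "\<not> Qf lam p (\<phi> t) > 0"
  define q where "q = (\<lambda>s. Qf lam p (\<phi> s))"
  have in_dom: "0 \<le> s \<and> ereal s < T" if "s \<in> {0..t}" for s
    using that t(2) by (auto intro: le_less_trans[of _ "ereal t"])
  have "continuous_on {0..t} (\<lambda>s. pmass p (\<phi> s))"
    unfolding continuous_on_def
  proof
    fix s assume s: "s \<in> {0..t}"
    show "((\<lambda>s. pmass p (\<phi> s)) \<longlongrightarrow> pmass p (\<phi> s)) (at s within {0..t})"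
    proof (rule pmass_tendsto)
      show "H1 (\<phi> s)" using max_sol_slice[OF sol] in_dom[OF s] by blast
      have "H1 (\<phi> r)" if "r \<in> {0..t}" for r using max_sol_slice(1)[OF sol] in_dom[OF that] by blast
      then show "\<forall>\<^sub>F r in at s within {0..t}. H1 (\<phi> r)"
        unfolding eventually_at_filter by (intro always_eventually) blast
      have "((\<lambda>r. H1norm (\<lambda>x. \<phi> r x - \<phi> s x)) \<longlongrightarrow> 0) (at s within {r. 0 \<le> r \<and> ereal r < T})"
        using sol in_dom[OF s] by (simp add: max_sol_def)
      then show "((\<lambda>r. H1norm (\<lambda>x. \<phi> r x - \<phi> s x)) \<longlongrightarrow> 0) (at s within {0..t})"
        by (rule tendsto_within_subset) (use in_dom in auto)
    qed (use p in simp)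
  qed
  then have "continuous_on {0..t} (\<lambda>s. 2 * Energy lam p \<phi>0 - lam * (p - 4) / p * pmass p (\<phi> s))"
    by (intro continuous_intros)
  moreover have "2 * Energy lam p \<phi>0 - lam * (p - 4) / p * pmass p (\<phi> s) = q s" if "s \<in> {0..t}" for s
    using max_sol_slice(3)[OF sol] in_dom[OF that] p by (simp add: q_def Qf_eq_Energy)
  ultimately have "continuous_on {0..t} q" by (rule continuous_on_eq)
  moreover have "\<phi> 0 = \<phi>0" using sol by (simp add: max_sol_def)
  then have "q 0 > 0" using O by (simp add: q_def Oc_def)
  ultimately obtain s where s: "0 \<le> s" "s \<le> t" "q s = 0"
    using IVT2'[of q t 0 0] neg t(1) by (auto simp: q_def)
  note m = max_sol_slice[OF sol, of s]
  have "mass \<phi>0 = c" using O by (simp add: Oc_def Sc_def mass_def)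
  then have "\<phi> s \<in> Mc lam p c"
    using m in_dom[of s] s by (simp add: Mc_def Sc_def mass_def q_def)
  then have "gamma_c lam p c \<le> ereal (Energy lam p (\<phi> s))"
    unfolding gamma_c_def by (rule INF_lower)
  also have "\<dots> = ereal (Energy lam p \<phi>0)" using m in_dom[of s] s by simp
  also have "\<dots> < gamma_c lam p c" using O by (simp add: Oc_def)
  finally show False by simp
qed

text \<open>With X the kinetic energy, 2 (p - 2) E = (p - 4) X + 2 Q. For p > 4 a positive Q
  therefore bounds X by a multiple of the conserved energy.\<close>

lemma global_supercritical:
  assumes p: "p > 4" and sol: "max_sol lam p \<phi>0 T \<phi>" and O: "\<phi>0 \<in> Oc lam p c"
  shows "T = \<infinity>"
proof (rule no_blowup[OF sol])
  fix t :: real assume t: "0 \<le> t" "ereal t < T"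
  define X where "X = kin (\<lambda>j. Dcov j (\<phi> t))"
  define N where "N = lam / p * pmass p (\<phi> t)"
  have Q: "X - (p - 2) * N > 0"
    using Qf_pos_along_flow[OF _ sol O t] p by (simp add: Qf_eq X_def N_def mult_ac)
  have E: "Energy lam p \<phi>0 = X / 2 - N"
    using max_sol_slice(3)[OF sol t] by (simp add: Energy_eq X_def N_def)
  have eq: "(p - 2) * (2 * Energy lam p \<phi>0) = (p - 4) * X + 2 * (X - (p - 2) * N)"
    unfolding E by (simp add: algebra_simps)
  have "(p - 4) * X \<le> (p - 2) * (2 * Energy lam p \<phi>0)"
    unfolding eq using less_imp_le[OF Q] by (intro add_increasing2) simp_all
  then show "kin (\<lambda>j. Dcov j (\<phi> t)) \<le> (p - 2) * (2 * Energy lam p \<phi>0) / (p - 4)"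
    using p by (simp add: X_def pos_le_divide_eq mult.commute)
qed

theorem theorem1p7:
  fixes lam p :: real
  assumes "lam > 0" and "p > 2"
  shows "\<exists>c0>0. \<forall>(\<phi>0::cfun) (T::ereal) (\<phi>::real \<Rightarrow> cfun).
           max_sol lam p \<phi>0 T \<phi> \<longrightarrow>
           (p < 4 \<or> (p = 4 \<and> L2norm \<phi>0 < c0) \<or> (p > 4 \<and> (\<exists>c>0. \<phi>0 \<in> Oc lam p c))) \<longrightarrow>
           T = \<infinity>"
proof -
  \<comment> \<open>The threshold depends on \<open>lam\<close> alone and is fixed before the
    initial data.\<close>
  obtain c0 where c0: "c0 > 0" "\<And>\<phi>0 T \<phi>. max_sol lam 4 \<phi>0 T \<phi> \<Longrightarrow> L2norm \<phi>0 < c0 \<Longrightarrow> T = \<infinity>"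
    using global_critical[OF assms(1)] by blast
  show ?thesis
  proof (intro exI[of _ c0] conjI allI impI c0(1))
    fix \<phi>0 T \<phi>
    assume sol: "max_sol lam p \<phi>0 T \<phi>"
      and "p < 4 \<or> (p = 4 \<and> L2norm \<phi>0 < c0) \<or> (p > 4 \<and> (\<exists>c>0. \<phi>0 \<in> Oc lam p c))"
    then show "T = \<infinity>"
      using global_subcritical[OF assms _ sol] c0(2)[of \<phi>0 T \<phi>] global_supercritical[OF _ sol] by blast
  qed
qed

end
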